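(* Let $d\geq3$ be a prime, and let $p\equiv1\pmod{2d}$ be a prime of the form $p=(a^d-1)/(a-1)$ for some integer $a\neq-1,0,1$. Let $H=\{a^k:0\le k\le d-1\}$, a subgroup of order $d$ of $(\mathbb Z/p\mathbb Z)^*$. Then $$M(p,H)=\frac{\pi^2}{6}\cdot\frac{a+1}{a-1}\cdot\left(1-\frac{(d-1)a+1}{p}\right)$$ and $$M_2(p,H)=\frac{\pi^2}{8}\times\begin{cases}\frac{a+1}{a-1}\left(1-\frac dp\right)&\text{if $a$ is odd},\\[1mm] 1-\frac{(d-1)a+1}{p}&\text{if $a$ is even.}\end{cases}$$ Consequently, for a given $d$, as $p\to\infty$, $M(p,H)=\frac{\pi^2}{6}+o(1)$ and $M_2(p,H)=\frac{\pi^2}{8}+o(1)$; and for a given $a$, as $p\to\infty$, $M(p,H)=\frac{\pi^2}{6}\cdot\frac{a+1}{a-1}+o(1)$, while $M_2(p,H)=\frac{\pi^2}{8}\cdot\frac{a+1}{a-1}+o(1)$ if $a$ is odd and $M_2(p,H)=\frac{\pi^2}{8}+o(1)$ if $a$ is even.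
   Context: For a prime $p\ge3$ and a subgroup $H$ of $(\mathbb Z/p\mathbb Z)^*$ of odd order, $X_p^-(H)$ is the set of Dirichlet characters $\chi$ mod $p$ with $\chi(-1)=-1$ and $\chi|_H=1$, and $L(1,\chi)=\sum_{n\ge1}\chi(n)/n$. $M(p,H)=\frac{1}{\#X_p^-(H)}\sum_{\chi\in X_p^-(H)}|L(1,\chi)|^2$, and $M_2(p,H)=\frac{1}{\#X_p^-(H)}\sum_{\chi\in X_p^-(H)}|L(1,\chi')|^2$ where $\chi'$ is the character modulo $2p$ induced by $\chi$. *)

theory Defs
  imports
    Complex_Main
    "HOL-Number_Theory.Number_Theory"
    "HOL-Library.Landau_Symbols"
begin

definition dirichlet_character :: "nat \<Rightarrow> (int \<Rightarrow> complex) \<Rightarrow> bool" where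
  "dirichlet_character m \<chi> \<longleftrightarrow>
     (\<forall>x y. \<chi> (x * y) = \<chi> x * \<chi> y) \<and>
     (\<forall>x. \<chi> (x + int m) = \<chi> x) \<and>
     (\<forall>x. \<chi> x \<noteq> 0 \<longleftrightarrow> coprime x (int m))"

text \<open>The series is in general only conditionally convergent, so it is summed in the
  natural order of the index.\<close>

definition L_one :: "(int \<Rightarrow> complex) \<Rightarrow> complex" where
  "L_one \<chi> = (\<Sum>n. \<chi> (int (Suc n)) / of_nat (Suc n))"

definition induced_character :: "nat \<Rightarrow> (int \<Rightarrow> complex) \<Rightarrow> int \<Rightarrow> complex" where
  "induced_character m \<chi> = (\<lambda>x. if coprime x (int m) then \<chi> x else 0)"

text \<open>Subgroups of the unit group modulo \<open>p\<close> are sets of representatives in \<open>{0..p - 1}\<close>,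
  as in \<open>units_of (residue_ring (int p))\<close>.\<close>

definition odd_characters :: "nat \<Rightarrow> int set \<Rightarrow> (int \<Rightarrow> complex) set" where
  "odd_characters p H =
     {\<chi>. dirichlet_character p \<chi> \<and> \<chi> (- 1) = - 1 \<and> (\<forall>h\<in>H. \<chi> h = 1)}"

definition M :: "nat \<Rightarrow> int set \<Rightarrow> real" where
  "M p H = 1 / real (card (odd_characters p H)) *
     (\<Sum>\<chi>\<in>odd_characters p H. (cmod (L_one \<chi>))\<^sup>2)"

definition M2 :: "nat \<Rightarrow> int set \<Rightarrow> real" where
  "M2 p H = 1 / real (card (odd_characters p H)) *
     (\<Sum>\<chi>\<in>odd_characters p H. (cmod (L_one (induced_character (2 * p) \<chi>)))\<^sup>2)"

definition repunit_prime :: "int \<Rightarrow> nat \<Rightarrow> nat \<Rightarrow> bool" where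
  "repunit_prime a d p \<longleftrightarrow>
     prime d \<and> d \<ge> 3 \<and> a \<notin> {- 1, 0, 1} \<and>
     prime p \<and> [p = 1] (mod 2 * d) \<and>
     real p = (real_of_int a ^ d - 1) / (real_of_int a - 1)"

definition power_subgroup :: "int \<Rightarrow> nat \<Rightarrow> nat \<Rightarrow> int set" where
  "power_subgroup a d p = (\<lambda>k. a ^ k mod int p) ` {0..d - 1}"

text \<open>The filter ``\<open>p \<rightarrow> \<infinity>\<close>'' on the pairs \<open>(x, p)\<close> that satisfy \<open>P\<close>. It is \<open>bot\<close>, and
  asymptotic statements along it are vacuous, if these \<open>p\<close> are bounded.\<close>

definition p_to_infinity :: "('a \<Rightarrow> nat \<Rightarrow> bool) \<Rightarrow> ('a \<times> nat) filter" where
  "p_to_infinity P = inf (filtercomap snd at_top) (principal {(x, p). P x p})"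

end

theory Submission
  imports Defs "HOL-Analysis.Gamma_Function"
begin

text \<open>
  Partial fractions of the cotangent (the reflection formula of the digamma function) give
  \<open>L(1, \<psi>) = \<pi> / (2 n) \<cdot> \<Sum> \<psi>(x) cot (\<pi> x / n)\<close> for every odd \<open>n\<close>-periodic \<open>\<psi>\<close>. With \<open>n = p\<close>, orthogonality
  of the odd characters that are trivial on \<open>H\<close> and Parseval's identity on the integers modulo \<open>p\<close>
  turn \<open>M p H\<close> into \<open>(2 \<pi>\<^sup>2 / p) \<cdot> \<Sum> s(h, p)\<close>, a sum of Dedekind sums over \<open>h \<in> H\<close>. With \<open>n = 2 p\<close> the
  cotangents become tangents, whose Fourier transform is \<open>(- 1) ^ x\<close> on \<open>0 < x < p\<close>, and \<open>M2 p H\<close> is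
  obtained from the sums of \<open>(- 1) ^ (x + (h x mod p))\<close>. For \<open>h = a ^ k\<close> all of these sums
  are evaluated by two applications of a reciprocity law, because with \<open>q = 1 + a + \<dots> + a ^ (k - 1)\<close>
  one has \<open>p \<equiv> q\<close> modulo \<open>a ^ k\<close> and \<open>a ^ k \<equiv> 1\<close> modulo \<open>q\<close>.
\<close>

section \<open>Dedekind sums\<close>

text \<open>The factor (a + 1) / (a - 1) has two sources. In 12 times the sum of Dedekind sums,
  \<open>h = 1\<close> contributes about p, and the nontrivial powers contribute twice the sum of
  \<open>repunit a k\<close> over 0 < k < d, which is 2 (p - d) / (a - 1); relative to p this is 1 +
  2 / (a - 1). For \<open>M2\<close> with odd \<open>a\<close> the same repunit sums occur. With
  even \<open>a\<close> each nontrivial power contributes only \<open>- a\<close>, and the factor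
  disappears. One obstacle is the sign of \<open>a\<close>: for odd \<open>d\<close> a prime repunit
  may have a negative base, and then \<open>a ^ k\<close> and \<open>repunit a k\<close>, which
  serve as moduli between the two applications of reciprocity, can be negative. The other is parity.
  For odd p the sign of \<open>h x mod p\<close> is that of \<open>h x + h x div p\<close>, so the
  sum to be evaluated takes a different shape for odd and for even h, and the two parities of
  \<open>a\<close> need different reciprocity laws.\<close>

definition sawtooth :: "int \<Rightarrow> int \<Rightarrow> real" where
  "sawtooth n x = (if n dvd x then 0 else of_int (x mod n) / of_int n - 1 / 2)"

definition parity_sign :: "int \<Rightarrow> real" where
  "parity_sign x = (if even x then 1 else - 1)"

lemma parity_sign_add: "parity_sign (x + y) = parity_sign x * parity_sign y"
  by (auto simp: parity_sign_def)

lemma parity_sign_even [simp]: "even x \<Longrightarrow> parity_sign x = 1"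
  and parity_sign_odd [simp]: "odd x \<Longrightarrow> parity_sign x = - 1"
  by (auto simp: parity_sign_def)

lemma sawtooth_mod [simp]: "sawtooth n (x mod n) = sawtooth n x"
  by (simp add: sawtooth_def dvd_mod_iff)

lemma sawtooth_cong: "[x = y] (mod n) \<Longrightarrow> sawtooth n x = sawtooth n y"
  by (metis sawtooth_mod Cong.cong_def)

text \<open>The value 0 at multiples of \<open>n\<close> is chosen for this oddness;
  \<open>x mod n / n - 1 / 2\<close> alone would violate it there.\<close>

lemma sawtooth_minus:
  assumes "n > 0"
  shows "sawtooth n (- x) = - sawtooth n x"
proof (cases "n dvd x")
  case False
  then have "(- x) mod n = n - x mod n"
    by (simp add: zmod_zminus1_eq_if dvd_eq_mod_eq_0)
  with False assms show ?thesis
    by (simp add: sawtooth_def diff_divide_distrib)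
qed (simp add: sawtooth_def)

lemma sawtooth_eq:
  assumes "1 \<le> x" "x \<le> n - 1"
  shows "sawtooth n x = of_int x / of_int n - 1 / 2"
  using assms zdvd_not_zless[of x n] by (simp add: sawtooth_def)

lemma not_dvd_mult_coprime:
  fixes c n x :: int
  assumes "coprime c n" "1 \<le> x" "x \<le> n - 1"
  shows "\<not> n dvd c * x"
  using assms zdvd_not_zless[of x n] by (auto simp: coprime_dvd_mult_right_iff coprime_commute)

text \<open>Through this expression of the floor \<open>c * x div n\<close>, lattice-point counts
  become sums of sawtooth values. Coprimality keeps the argument off the exceptional multiples of
  \<open>n\<close>.\<close>

lemma sawtooth_mult_eq:
  assumes "coprime c n" "1 \<le> x" "x \<le> n - 1"
  shows "sawtooth n (c * x) = of_int c * of_int x / of_int n - of_int (c * x div n) - 1 / 2"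
proof -
  have "real_of_int (c * x) = of_int (c * x div n) * of_int n + of_int (c * x mod n)"
    by (metis of_int_add of_int_mult div_mult_mod_eq)
  moreover have "n \<noteq> 0" using assms by auto
  ultimately show ?thesis
    using not_dvd_mult_coprime[OF assms] by (simp add: sawtooth_def field_simps)
qed

lemma bij_betw_mult_mod:
  fixes c n :: int
  assumes "coprime c n"
  shows "bij_betw (\<lambda>x. c * x mod n) {1..n - 1} {1..n - 1}"
proof -
  have inj: "inj_on (\<lambda>x. c * x mod n) {1..n - 1}"
  proof (rule inj_onI)
    fix x y assume xy: "x \<in> {1..n - 1}" "y \<in> {1..n - 1}" "c * x mod n = c * y mod n"
    then have "[c * x = c * y] (mod n)" unfolding Cong.cong_def by blast
    then have "[x = y] (mod n)" using assms cong_mult_lcancel by blast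
    with xy show "x = y" by (auto simp: Cong.cong_def)
  qed
  have "(\<lambda>x. c * x mod n) ` {1..n - 1} \<subseteq> {1..n - 1}"
  proof (rule image_subsetI)
    fix x assume x: "x \<in> {1..n - 1}"
    then have "c * x mod n \<noteq> 0"
      using not_dvd_mult_coprime[of c n x] assms by (auto simp: dvd_eq_mod_eq_0)
    moreover have "0 \<le> c * x mod n" "c * x mod n < n" using x by auto
    ultimately show "c * x mod n \<in> {1..n - 1}" by auto
  qed
  then show ?thesis
    using inj endo_inj_surj[of "{1..n - 1}"] by (auto simp: bij_betw_def)
qed

lemma sum_mult_mod:
  fixes c n :: int
  assumes "coprime c n" "\<And>x. f (x mod n) = f x"
  shows "(\<Sum>x=1..n-1. f (c * x)) = (\<Sum>x=1..n-1. f x)"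
  using sum.reindex_bij_betw[OF bij_betw_mult_mod[OF assms(1)], of f] by (simp add: assms(2))

lemma sum_of_int_atLeastAtMost:
  fixes n :: int
  assumes "n \<ge> 1"
  shows "(\<Sum>x=1..n-1. real_of_int x) = of_int n * (of_int n - 1) / 2"
    and "(\<Sum>x=1..n-1. (real_of_int x)\<^sup>2) = of_int n * (of_int n - 1) * (2 * of_int n - 1) / 6"
proof -
  have insert: "{1..i} = insert i {1..i - 1}" if "i \<ge> 1" for i :: int using that by auto
  show "(\<Sum>x=1..n-1. real_of_int x) = of_int n * (of_int n - 1) / 2" using assms
  proof (induction n rule: int_ge_induct)
    case (step i)
    have "(\<Sum>x=1..i+1-1. real_of_int x) = of_int i + (\<Sum>x=1..i-1. of_int x)"
      using step.hyps by (simp add: insert)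
    then show ?case unfolding step.IH by (simp add: field_simps)
  qed simp
  show "(\<Sum>x=1..n-1. (real_of_int x)\<^sup>2) = of_int n * (of_int n - 1) * (2 * of_int n - 1) / 6"
    using assms
  proof (induction n rule: int_ge_induct)
    case (step i)
    have "(\<Sum>x=1..i+1-1. (real_of_int x)\<^sup>2) = (of_int i)\<^sup>2 + (\<Sum>x=1..i-1. (of_int x)\<^sup>2)"
      using step.hyps by (simp add: insert)
    then show ?case unfolding step.IH by (simp add: field_simps power2_eq_square)
  qed simp
qed

lemma le_div_int_iff:
  fixes a b n :: int
  assumes "n > 0"
  shows "b \<le> a div n \<longleftrightarrow> b * n \<le> a"
proof
  assume "b \<le> a div n"
  then have "b * n \<le> a div n * n" using assms by simp
  also have "\<dots> \<le> a" using assms by (metis div_mult_mod_eq le_add_same_cancel1 pos_mod_sign)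
  finally show "b * n \<le> a" .
next
  assume "b * n \<le> a"
  then have "b * n div n \<le> a div n" using assms by (intro zdiv_mono1)
  then show "b \<le> a div n" using assms by simp
qed

lemma div_less_int_iff:
  fixes a b n :: int
  assumes "n > 0"
  shows "a div n < b \<longleftrightarrow> a < b * n"
  using le_div_int_iff[OF assms, of b a] by linarith

lemma sum_sawtooth:
  assumes "n \<ge> 1"
  shows "(\<Sum>x=1..n-1. sawtooth n x) = 0"
proof -
  have "(\<Sum>x=1..n-1. sawtooth n x) = (\<Sum>x=1..n-1. of_int x / of_int n - 1 / 2)"
    by (intro sum.cong refl sawtooth_eq) auto
  also have "\<dots> = (\<Sum>x=1..n-1. real_of_int x) / of_int n - (of_int n - 1) / 2"
    using assms by (simp add: sum_subtractf sum_divide_distrib)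
  also have "\<dots> = 0" using assms by (simp add: sum_of_int_atLeastAtMost field_simps)
  finally show ?thesis .
qed

lemma sum_sawtooth_square:
  assumes "n \<ge> 1"
  shows "(\<Sum>x=1..n-1. (sawtooth n x)\<^sup>2) = (of_int n - 1) * (of_int n - 2) / (12 * of_int n)"
proof -
  have "(\<Sum>x=1..n-1. (sawtooth n x)\<^sup>2) =
    (\<Sum>x=1..n-1. (of_int x)\<^sup>2 / (of_int n)\<^sup>2 - of_int x / of_int n + 1 / 4)"
    by (intro sum.cong refl) (auto simp: sawtooth_eq power2_eq_square field_simps)
  also have "\<dots> = (\<Sum>x=1..n-1. (real_of_int x)\<^sup>2) / (of_int n)\<^sup>2
      - (\<Sum>x=1..n-1. real_of_int x) / of_int n + (of_int n - 1) / 4"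
    using assms by (simp add: sum_subtractf sum.distrib sum_divide_distrib)
  also have "\<dots> = (of_int n - 1) * (of_int n - 2) / (12 * of_int n)"
    unfolding sum_of_int_atLeastAtMost[OF assms] using assms
    by (simp add: divide_simps power2_eq_square) (simp add: algebra_simps)
  finally show ?thesis .
qed

text \<open>Both sides sum \<open>w j\<close> over the lattice points \<open>(x, j)\<close> of the open rectangle
  \<open>(0, n) \<times> (0, c)\<close> on one side of its diagonal.\<close>

lemma sum_lattice_points:
  fixes c n :: int and w :: "int \<Rightarrow> real"
  assumes "coprime c n" "c > 0" "n > 0"
  shows "(\<Sum>x=1..n-1. \<Sum>j=1..c * x div n. w j) =
    (\<Sum>j=1..c-1. w j * of_int (n - 1 - n * j div c))"
proof -
  have "(\<Sum>x=1..n-1. \<Sum>j=1..c * x div n. w j) =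
    (\<Sum>x=1..n-1. \<Sum>j=1..c-1. if j * n \<le> c * x then w j else 0)"
  proof (rule sum.cong[OF refl])
    fix x assume x: "x \<in> {1..n - 1}"
    have "c * x < c * n" using x assms by auto
    then have "c * x div n \<le> c - 1"
      using div_less_int_iff[of n "c * x" c] assms by simp
    then have "{1..c * x div n} = {j \<in> {1..c - 1}. j \<le> c * x div n}"
      by auto
    also have "\<dots> = {j \<in> {1..c - 1}. j * n \<le> c * x}"
      using assms by (simp add: le_div_int_iff)
    finally have "{1..c * x div n} = {j \<in> {1..c - 1}. j * n \<le> c * x}" .
    then show "(\<Sum>j=1..c * x div n. w j) = (\<Sum>j=1..c-1. if j * n \<le> c * x then w j else 0)"
      by (simp only: sum.inter_filter[OF finite_atLeastAtMost_int])
  qed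
  also have "\<dots> = (\<Sum>j=1..c-1. \<Sum>x=1..n-1. if j * n \<le> c * x then w j else 0)"
    by (rule sum.swap)
  also have "\<dots> = (\<Sum>j=1..c-1. w j * of_int (n - 1 - n * j div c))"
  proof (rule sum.cong[OF refl])
    fix j assume j: "j \<in> {1..c - 1}"
    \<comment> \<open>No lattice point lies on the diagonal, so the weak inequality may be read as a
      strict one, which is the form that \<open>div_less_int_iff\<close> inverts.\<close>
    have nd: "\<not> c dvd n * j"
      using not_dvd_mult_coprime[of n c j] j assms by (auto simp: coprime_commute)
    have pos: "0 \<le> n * j div c" using j assms by (simp add: pos_imp_zdiv_nonneg_iff)
    have "n * j < n * c" using j assms by auto
    then have less: "n * j div c \<le> n - 1"
      using div_less_int_iff[of c "n * j" n] assms by simp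
    have iff: "j * n \<le> c * x \<longleftrightarrow> n * j div c < x" for x
    proof -
      have "j * n \<le> c * x \<longleftrightarrow> n * j < x * c"
        using nd by (metis dvd_triv_right le_less mult.commute)
      then show ?thesis using assms by (simp add: div_less_int_iff)
    qed
    have "{x \<in> {1..n - 1}. j * n \<le> c * x} = {n * j div c + 1..n - 1}"
      unfolding iff using pos by auto
    then show "(\<Sum>x=1..n-1. if j * n \<le> c * x then w j else 0) =
        w j * of_int (n - 1 - n * j div c)"
      using less by (simp only: sum.inter_filter[OF finite_atLeastAtMost_int, symmetric]) simp
  qed
  finally show ?thesis .
qed

text \<open>The sums below are extended to negative moduli as odd functions of the modulus, so that
  their reciprocity laws hold for both signs, with \<open>sgn (c * n)\<close> in the constant term.\<close>

definition dedekind_sum :: "int \<Rightarrow> int \<Rightarrow> real" where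
  "dedekind_sum c n = sgn (of_int n) * (\<Sum>x=1..\<bar>n\<bar>-1. sawtooth \<bar>n\<bar> x * sawtooth \<bar>n\<bar> (c * x))"

lemma dedekind_sum_minus_left: "dedekind_sum (- c) n = - dedekind_sum c n"
  by (cases "n = 0") (simp_all add: dedekind_sum_def sawtooth_minus sum_negf)

lemma dedekind_sum_minus_right: "dedekind_sum c (- n) = - dedekind_sum c n"
  by (simp add: dedekind_sum_def sgn_minus)

lemma dedekind_sum_cong:
  assumes "[b = c] (mod n)"
  shows "dedekind_sum b n = dedekind_sum c n"
proof -
  have "sawtooth \<bar>n\<bar> (b * x) = sawtooth \<bar>n\<bar> (c * x)" for x
    using assms by (intro sawtooth_cong cong_mult cong_refl) (auto simp: cong_iff_dvd_diff)
  then show ?thesis by (simp add: dedekind_sum_def)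
qed

lemma dedekind_sum_1:
  assumes "n > 0"
  shows "dedekind_sum 1 n = (of_int n - 1) * (of_int n - 2) / (12 * of_int n)"
  using assms sum_sawtooth_square[of n] by (simp add: dedekind_sum_def power2_eq_square)

text \<open>Both sides being odd in each variable, the identity spreads from the positive quadrant.
  Oddness of \<open>f\<close> is asked only under \<open>P\<close>, since the floor sums change sign
  with \<open>c\<close> for coprime arguments; \<open>P\<close> is tested on absolute values, which
  preserve coprimality and parity.\<close>

lemma reciprocity_extend_signs:
  fixes f g :: "int \<Rightarrow> int \<Rightarrow> real"
  assumes f: "\<And>c n. P \<bar>c\<bar> \<bar>n\<bar> \<Longrightarrow> f (- c) n = - f c n" "\<And>c n. P \<bar>c\<bar> \<bar>n\<bar> \<Longrightarrow> f c (- n) = - f c n"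
    and g: "\<And>c n. g (- c) n = - g c n" "\<And>c n. g c (- n) = - g c n"
    and pos: "\<And>c n. P c n \<Longrightarrow> c > 0 \<Longrightarrow> n > 0 \<Longrightarrow> f c n = g c n"
    and P: "P \<bar>c\<bar> \<bar>n\<bar>" and nz: "c \<noteq> 0" "n \<noteq> 0"
  shows "f c n = g c n"
proof -
  have abs: "f (abs c) (abs n) = g (abs c) (abs n)" using P nz by (intro pos) auto
  have 1: "f (abs c) m = (if c < 0 then - f c m else f c m)" if "abs m = abs n" for m
    using f(1)[of c m] P that by (simp add: abs_if split: if_splits)
  have 2: "f c (abs n) = (if n < 0 then - f c n else f c n)"
    using f(2)[of c n] P by (simp add: abs_if split: if_splits)
  show ?thesis
    using abs 1[of "abs n"] 2 by (simp add: abs_if g split: if_splits)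
qed

text \<open>Evaluates the sum of \<open>f x * (f x + 1)\<close>, with \<open>f x\<close> the floor
  of \<open>c x / n\<close>, in two ways. As \<open>f x * (f x + 1)\<close> is the sum of
  \<open>2 j\<close> over \<open>j\<close> up to \<open>f x\<close>, the lattice-point exchange
  leads to \<open>dedekind_sum n c\<close>; expanding the floor by the sawtooth leads to
  \<open>dedekind_sum c n\<close>.\<close>

lemma dedekind_reciprocity_pos:
  assumes cop: "coprime c n" and "c > 0" "n > 0"
  shows "12 * (dedekind_sum c n + dedekind_sum n c) =
    - 3 + of_int c / of_int n + of_int n / of_int c + 1 / (of_int c * of_int n)"
proof -
  define f where "f = (\<lambda>x. real_of_int (c * x div n))"
  define Q where "Q = (\<lambda>n::int. (real_of_int n - 1) * (of_int n - 2) / (12 * of_int n))"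
  define C where "C = real_of_int c"
  define N where "N = real_of_int n"
  have cop': "coprime n c" using cop by (simp add: coprime_commute)
  have pos: "C > 0" "N > 0" using assms by (simp_all add: C_def N_def)
  have Gauss: "(\<Sum>j=1..m. 2 * real_of_int j) = of_int m * (of_int m + 1)" if "m \<ge> 0" for m :: int
    using sum_of_int_atLeastAtMost(1)[of "m + 1"] that
    by (simp only: sum_distrib_left[symmetric]) (simp add: field_simps)
  have "(\<Sum>x=1..n-1. f x * (f x + 1)) = (\<Sum>x=1..n-1. \<Sum>j=1..c * x div n. 2 * of_int j)"
    using assms
    by (intro sum.cong refl) (simp add: Gauss f_def pos_imp_zdiv_nonneg_iff)
  also have "\<dots> = (\<Sum>j=1..c-1. 2 * of_int j * of_int (n - 1 - n * j div c))"
    using sum_lattice_points[OF assms] .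
  \<comment> \<open>Both \<open>j\<close> and \<open>n * j div c\<close> are expressed by sawtooth
    values modulo \<open>c\<close>.\<close>
  also have "\<dots> = (\<Sum>j=1..c-1. 2 * C * (- N * (sawtooth c j)\<^sup>2
      + sawtooth c j * sawtooth c (n * j) + (N - 1) / 4
      - 1 / 2 * sawtooth c j + 1 / 2 * sawtooth c (n * j)))"
  proof (rule sum.cong[OF refl])
    fix j assume j: "j \<in> {1..c - 1}"
    define u where "u = sawtooth c j"
    define v where "v = sawtooth c (n * j)"
    have 1: "real_of_int j = C * (u + 1 / 2)"
      using j assms by (simp add: u_def sawtooth_eq C_def)
    have "of_int (n * j div c) = N * (of_int j / C) - 1 / 2 - v"
      using j assms by (simp add: v_def sawtooth_mult_eq[OF cop'] C_def N_def)
    also have "of_int j / C = u + 1 / 2" using 1 pos by simp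
    finally have 2: "real_of_int (n - 1 - n * j div c) = N - 1 - (N * (u + 1 / 2) - 1 / 2 - v)"
      by (simp add: N_def)
    show "2 * of_int j * of_int (n - 1 - n * j div c) = 2 * C * (- N * (sawtooth c j)\<^sup>2
      + sawtooth c j * sawtooth c (n * j) + (N - 1) / 4
      - 1 / 2 * sawtooth c j + 1 / 2 * sawtooth c (n * j))"
      unfolding 1 2 u_def[symmetric] v_def[symmetric]
      by (simp add: field_simps power2_eq_square)
  qed
  also have "\<dots> = 2 * C * (- N * (\<Sum>j=1..c-1. (sawtooth c j)\<^sup>2)
      + (\<Sum>j=1..c-1. sawtooth c j * sawtooth c (n * j)) + (C - 1) * ((N - 1) / 4)
      - 1 / 2 * (\<Sum>j=1..c-1. sawtooth c j)
      + 1 / 2 * (\<Sum>j=1..c-1. sawtooth c (n * j)))"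
    using assms
    by (simp only: sum.distrib sum_subtractf sum_distrib_left[symmetric]) (simp add: C_def)
  also have "\<dots> = 2 * C * (- N * Q c + dedekind_sum n c + (C - 1) * ((N - 1) / 4))"
    using assms
    by (simp add: sum_mult_mod[OF cop', of "sawtooth c"] sum_sawtooth sum_sawtooth_square Q_def
        dedekind_sum_def)
  finally have 1: "(\<Sum>x=1..n-1. f x * (f x + 1)) = \<dots>" .
  \<comment> \<open>Second evaluation, modulo \<open>n\<close>: the floor is
    \<open>C * (u + 1 / 2) - 1 / 2 - v\<close> with the sawtooth values \<open>u\<close> at
    \<open>x\<close> and \<open>v\<close> at \<open>c * x\<close>.\<close>
  have "(\<Sum>x=1..n-1. f x * (f x + 1)) = (\<Sum>x=1..n-1. C\<^sup>2 * (sawtooth n x)\<^sup>2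
     + (sawtooth n (c * x))\<^sup>2 - 2 * C * (sawtooth n x * sawtooth n (c * x))
     + (C\<^sup>2 - 1) / 4 + C\<^sup>2 * sawtooth n x - C * sawtooth n (c * x))"
  proof (rule sum.cong[OF refl])
    fix x assume x: "x \<in> {1..n - 1}"
    define u where "u = sawtooth n x"
    define v where "v = sawtooth n (c * x)"
    have "f x = C * (of_int x / N) - 1 / 2 - v"
      using x assms by (simp add: v_def sawtooth_mult_eq[OF cop] C_def N_def f_def)
    also have "of_int x / N = u + 1 / 2" using x by (simp add: u_def sawtooth_eq N_def)
    finally have 2: "f x = C * (u + 1 / 2) - 1 / 2 - v" .
    show "f x * (f x + 1) = C\<^sup>2 * (sawtooth n x)\<^sup>2
     + (sawtooth n (c * x))\<^sup>2 - 2 * C * (sawtooth n x * sawtooth n (c * x))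
     + (C\<^sup>2 - 1) / 4 + C\<^sup>2 * sawtooth n x - C * sawtooth n (c * x)"
      unfolding 2 u_def[symmetric] v_def[symmetric]
      by (simp add: field_simps power2_eq_square)
  qed
  also have "\<dots> = C\<^sup>2 * (\<Sum>x=1..n-1. (sawtooth n x)\<^sup>2)
     + (\<Sum>x=1..n-1. (sawtooth n (c * x))\<^sup>2)
     - 2 * C * (\<Sum>x=1..n-1. sawtooth n x * sawtooth n (c * x))
     + (N - 1) * ((C\<^sup>2 - 1) / 4) + C\<^sup>2 * (\<Sum>x=1..n-1. sawtooth n x)
     - C * (\<Sum>x=1..n-1. sawtooth n (c * x))"
    using assms
    by (simp only: sum.distrib sum_subtractf sum_distrib_left[symmetric]) (simp add: N_def)
  also have "\<dots> = C\<^sup>2 * Q n + Q n - 2 * C * dedekind_sum c n + (N - 1) * ((C\<^sup>2 - 1) / 4)"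
    using assms sum_mult_mod[OF cop, of "sawtooth n"]
      sum_mult_mod[OF cop, of "\<lambda>x. (sawtooth n x)\<^sup>2"]
    by (simp add: sum_sawtooth sum_sawtooth_square Q_def dedekind_sum_def)
  finally have "2 * C * (dedekind_sum c n + dedekind_sum n c) =
      (C\<^sup>2 + 1) * Q n + (N - 1) * ((C\<^sup>2 - 1) / 4) + 2 * C * N * Q c
      - 2 * C * ((C - 1) * ((N - 1) / 4))"
    unfolding 1 by (simp add: algebra_simps)
  then have "12 * (dedekind_sum c n + dedekind_sum n c) =
      6 * ((C\<^sup>2 + 1) * Q n + (N - 1) * ((C\<^sup>2 - 1) / 4) + 2 * C * N * Q c
      - 2 * C * ((C - 1) * ((N - 1) / 4))) / C"
    using pos by (simp add: field_simps)
  also have "\<dots> = - 3 + C / N + N / C + 1 / (C * N)"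
    using pos
    by (simp add: Q_def C_def[symmetric] N_def[symmetric] divide_simps)
       (simp add: algebra_simps power2_eq_square)
  finally show ?thesis by (simp add: C_def N_def)
qed

lemma dedekind_reciprocity:
  assumes "coprime c n" "c \<noteq> 0" "n \<noteq> 0"
  shows "12 * (dedekind_sum c n + dedekind_sum n c) =
    - 3 * sgn (of_int (c * n)) + of_int c / of_int n + of_int n / of_int c + 1 / (of_int c * of_int n)"
proof (rule reciprocity_extend_signs[where P = coprime and
        f = "\<lambda>c n. 12 * (dedekind_sum c n + dedekind_sum n c)" and
        g = "\<lambda>c n. - 3 * sgn (of_int (c * n)) + of_int c / of_int n + of_int n / of_int c
          + 1 / (of_int c * of_int n)"])
  fix c n :: int
  assume "coprime c n" "c > 0" "n > 0"
  then show "12 * (dedekind_sum c n + dedekind_sum n c) =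
    - 3 * sgn (of_int (c * n)) + of_int c / of_int n + of_int n / of_int c + 1 / (of_int c * of_int n)"
    using dedekind_reciprocity_pos[of c n] by simp
qed (use assms in \<open>simp_all add: dedekind_sum_minus_left dedekind_sum_minus_right sgn_minus\<close>)

text \<open>The closed form expanded into terms that are each odd in \<open>n\<close>, hence valid
  for both signs.\<close>

lemma dedekind_sum_1':
  assumes "n \<noteq> 0"
  shows "12 * dedekind_sum 1 n = of_int n + 2 / of_int n - 3 * sgn (of_int n)"
proof -
  have *: "12 * dedekind_sum 1 m = of_int m + 2 / of_int m - 3" if "m > 0" for m
    using that by (simp add: dedekind_sum_1 field_simps)
  show ?thesis
  proof (cases "n > 0")
    case False
    with assms have "- n > 0" by simp
    from *[OF this] this show ?thesis by (simp add: dedekind_sum_minus_right)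
  qed (simp add: *)
qed

section \<open>Alternating sums and repunits\<close>

lemma sum_parity_sign:
  assumes "m \<ge> 0"
  shows "(\<Sum>j=1..m. parity_sign j) = (parity_sign m - 1) / 2"
    and "(\<Sum>j=1..m. parity_sign j * of_int j) = (parity_sign m * (2 * of_int m + 1) - 1) / 4"
proof -
  have insert: "{1..i + 1} = insert (i + 1) {1..i}" if "i \<ge> 0" for i :: int using that by auto
  show "(\<Sum>j=1..m. parity_sign j) = (parity_sign m - 1) / 2" using assms
    by (induction m rule: int_ge_induct) (simp_all add: insert, simp add: parity_sign_def)
  show "(\<Sum>j=1..m. parity_sign j * of_int j) = (parity_sign m * (2 * of_int m + 1) - 1) / 4"
    using assms
    by (induction m rule: int_ge_induct) (simp_all add: insert, simp add: parity_sign_def)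
qed

lemma minus_div_of_not_dvd:
  fixes x n :: int
  assumes "\<not> n dvd x" "n \<noteq> 0"
  shows "(- x) div n = - (x div n) - 1"
  using assms by (simp add: zdiv_zminus1_eq_if dvd_eq_mod_eq_0)

section \<open>Hardy sums and their reciprocity laws\<close>

text \<open>For \<open>n > 0\<close> this and the next two are classical Hardy-Berndt sums:
  \<open>s_4\<close>, the negative of \<open>S\<close>, and \<open>s_3\<close>.\<close>

definition floor_sign_sum :: "int \<Rightarrow> int \<Rightarrow> real" where
  "floor_sign_sum c n = sgn (of_int n) * (\<Sum>x=1..\<bar>n\<bar>-1. parity_sign (c * x div \<bar>n\<bar>))"

definition hardy_sum :: "int \<Rightarrow> int \<Rightarrow> real" where
  "hardy_sum c n = sgn (of_int n) * (\<Sum>x=1..\<bar>n\<bar>-1. parity_sign (x + c * x div \<bar>n\<bar>))"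

definition alternating_sawtooth_sum :: "int \<Rightarrow> int \<Rightarrow> real" where
  "alternating_sawtooth_sum c n =
     sgn (of_int n) * (\<Sum>x=1..\<bar>n\<bar>-1. parity_sign x * sawtooth \<bar>n\<bar> (c * x))"

text \<open>For non-integral t the floor of -t is -1 minus the floor of t, and the extra -1 flips
  the sign.\<close>

lemma parity_sign_minus_div:
  assumes "coprime c n" "x \<in> {1..\<bar>n\<bar> - 1}"
  shows "parity_sign (y + - (c * x) div \<bar>n\<bar>) = - parity_sign (y + c * x div \<bar>n\<bar>)"
proof -
  have "\<not> \<bar>n\<bar> dvd c * x" using assms by (intro not_dvd_mult_coprime) auto
  moreover have "n \<noteq> 0" using assms by auto
  ultimately have "y + - (c * x) div \<bar>n\<bar> = (y + c * x div \<bar>n\<bar>) - 2 * (c * x div \<bar>n\<bar>) - 1"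
    by (simp add: minus_div_of_not_dvd)
  then show ?thesis by (simp add: parity_sign_def)
qed

lemma floor_sign_sum_minus:
  "coprime c n \<Longrightarrow> floor_sign_sum (- c) n = - floor_sign_sum c n"
  "floor_sign_sum c (- n) = - floor_sign_sum c n"
  using parity_sign_minus_div[of c n _ 0]
  by (simp_all add: floor_sign_sum_def sgn_minus sum_negf)

lemma hardy_sum_minus:
  "coprime c n \<Longrightarrow> hardy_sum (- c) n = - hardy_sum c n"
  "hardy_sum c (- n) = - hardy_sum c n"
  using parity_sign_minus_div[of c n]
  by (simp_all add: hardy_sum_def sgn_minus sum_negf)

lemma alternating_sawtooth_sum_minus:
  "alternating_sawtooth_sum (- c) n = - alternating_sawtooth_sum c n"
  "alternating_sawtooth_sum c (- n) = - alternating_sawtooth_sum c n"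
  by (cases "n = 0"; simp add: alternating_sawtooth_sum_def sgn_minus sawtooth_minus sum_negf)+

lemma alternating_sawtooth_sum_cong:
  assumes "[b = c] (mod n)"
  shows "alternating_sawtooth_sum b n = alternating_sawtooth_sum c n"
proof -
  have "sawtooth \<bar>n\<bar> (b * x) = sawtooth \<bar>n\<bar> (c * x)" for x
    using assms by (intro sawtooth_cong cong_mult cong_refl) (auto simp: cong_iff_dvd_diff)
  then show ?thesis by (simp add: alternating_sawtooth_sum_def)
qed

text \<open>Rests on (-1)^f = 1 + 2 * (sum of (-1)^j over 1 <= j <= f), which turns floor signs into
  a lattice-point sum. For odd \<open>c\<close> the plain alternating sum over 1, ..., c - 1
  vanishes, leaving the linear and the sawtooth terms.\<close>

lemma floor_sign_sum_reciprocity_pos: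
  assumes cop: "coprime c n" and odd: "odd c" and "c > 0" "n > 0"
  shows "floor_sign_sum c n = of_int n / of_int c - 1 + 2 * alternating_sawtooth_sum n c"
proof -
  define C where "C = real_of_int c"
  define N where "N = real_of_int n"
  have cop': "coprime n c" using cop by (simp add: coprime_commute)
  have pos: "C > 0" "N > 0" using assms by (simp_all add: C_def N_def)
  have even: "even (c - 1)" using odd by simp
  have "floor_sign_sum c n = (\<Sum>x=1..n-1. 1 + 2 * (\<Sum>j=1..c * x div n. parity_sign j))"
    using assms
    by (simp add: floor_sign_sum_def sum_parity_sign pos_imp_zdiv_nonneg_iff field_simps)
  also have "\<dots> = N - 1 + 2 * (\<Sum>x=1..n-1. (\<Sum>j=1..c * x div n. parity_sign j))"
    using assms by (simp only: sum.distrib sum_distrib_left[symmetric]) (simp add: N_def)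
  also have "(\<Sum>x=1..n-1. (\<Sum>j=1..c * x div n. parity_sign j)) =
      (\<Sum>j=1..c-1. parity_sign j * of_int (n - 1 - n * j div c))"
    by (rule sum_lattice_points) fact+
  also have "\<dots> = (\<Sum>j=1..c-1. (N - 1 / 2) * parity_sign j - N / C * (parity_sign j * of_int j)
      + parity_sign j * sawtooth c (n * j))"
  proof (rule sum.cong[OF refl])
    fix j assume j: "j \<in> {1..c - 1}"
    have "of_int (n * j div c) = N / C * of_int j - 1 / 2 - sawtooth c (n * j)"
      using j by (simp add: sawtooth_mult_eq[OF cop'] C_def N_def)
    then have div: "of_int (n - 1 - n * j div c) = N - 1 / 2 - N / C * of_int j + sawtooth c (n * j)"
      by (simp add: N_def)
    show "parity_sign j * of_int (n - 1 - n * j div c) =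
      (N - 1 / 2) * parity_sign j - N / C * (parity_sign j * of_int j)
      + parity_sign j * sawtooth c (n * j)"
      unfolding div by (simp only: ring_distribs mult_ac)
  qed
  also have "\<dots> = (N - 1 / 2) * (\<Sum>j=1..c-1. parity_sign j)
      - N / C * (\<Sum>j=1..c-1. parity_sign j * of_int j)
      + (\<Sum>j=1..c-1. parity_sign j * sawtooth c (n * j))"
    by (simp only: sum.distrib sum_subtractf sum_distrib_left[symmetric])
  also have "\<dots> = - N / C * ((C - 1) / 2) + alternating_sawtooth_sum n c"
  proof -
    have "(\<Sum>j=1..c-1. parity_sign j * of_int j) =
        (parity_sign (c - 1) * (2 * of_int (c - 1) + 1) - 1) / 4"
      using assms by (intro sum_parity_sign) simp
    also have "\<dots> = (C - 1) / 2" using even by (simp add: C_def field_simps)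
    finally have "(\<Sum>j=1..c-1. parity_sign j * of_int j) = (C - 1) / 2" .
    moreover have "(\<Sum>j=1..c-1. parity_sign j) = 0"
      using assms even by (simp add: sum_parity_sign)
    ultimately show ?thesis
      using assms by (simp only: alternating_sawtooth_sum_def) simp
  qed
  finally show ?thesis
    using pos by (simp add: C_def[symmetric] N_def[symmetric] field_simps)
qed

lemma floor_sign_sum_reciprocity:
  assumes "coprime c n" "odd c" "c \<noteq> 0" "n \<noteq> 0"
  shows "floor_sign_sum c n =
    of_int n / of_int c - sgn (of_int (c * n)) + 2 * alternating_sawtooth_sum n c"
proof (rule reciprocity_extend_signs[where P = "\<lambda>c n. coprime c n \<and> odd c" and
        f = floor_sign_sum and
        g = "\<lambda>c n. of_int n / of_int c - sgn (of_int (c * n)) + 2 * alternating_sawtooth_sum n c"])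
  fix c n :: int
  assume "coprime c n \<and> odd c" "c > 0" "n > 0"
  then show "floor_sign_sum c n =
      of_int n / of_int c - sgn (of_int (c * n)) + 2 * alternating_sawtooth_sum n c"
    by (simp add: floor_sign_sum_reciprocity_pos)
qed (use assms in \<open>simp_all add: floor_sign_sum_minus alternating_sawtooth_sum_minus sgn_minus\<close>)

text \<open>Listing the multiples of \<open>c\<close> and of \<open>n\<close> in the open interval \<open>(0, c * n)\<close> in increasing
  order, the multiple \<open>c * x\<close> has index \<open>x + c * x div n\<close>.\<close>

lemma merge_multiples:
  fixes c n :: int
  assumes "coprime c n" "c > 0" "n > 0"
  shows "(\<lambda>x. x + c * x div n) ` {1..n-1} \<union> (\<lambda>j. j + n * j div c) ` {1..c-1} = {1..c+n-2}"
    and "(\<lambda>x. x + c * x div n) ` {1..n-1} \<inter> (\<lambda>j. j + n * j div c) ` {1..c-1} = {}"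
    and "inj_on (\<lambda>x. x + c * x div n) {1..n-1}"
proof -
  have inj: "inj_on (\<lambda>x. x + u * x div v) {1..v-1}" if "u > 0" "v > 0" for u v :: int
  proof (rule linorder_inj_onI)
    fix x y :: int assume "x < y"
    moreover from this have "u * x div v \<le> u * y div v" using that by (intro zdiv_mono1) auto
    ultimately show "x + u * x div v \<noteq> y + u * y div v" by simp
  qed auto
  have sub: "(\<lambda>x. x + u * x div v) ` {1..v-1} \<subseteq> {1..u+v-2}" if "u > 0" "v > 0" for u v :: int
  proof (rule image_subsetI)
    fix x assume x: "x \<in> {1..v - 1}"
    then have "0 \<le> u * x div v" using that by (simp add: pos_imp_zdiv_nonneg_iff)
    moreover have "u * x div v < u" using x that by (simp add: div_less_int_iff)
    ultimately show "x + u * x div v \<in> {1..u+v-2}" using x by auto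
  qed
  \<comment> \<open>If \<open>u * x < v * j\<close>, the first floor is below \<open>j\<close> and
    the second is at least \<open>x\<close>; adding the two inequalities separates the
    indices.\<close>
  have neq: "x + u * x div v \<noteq> j + v * j div u"
    if "u > 0" "v > 0" "u * x < v * j" for u v x j :: int
  proof -
    have "u * x div v < j" using that by (simp add: div_less_int_iff mult.commute)
    moreover have "x \<le> v * j div u" using that by (simp add: le_div_int_iff mult.commute)
    ultimately show ?thesis by linarith
  qed
  show disj: "(\<lambda>x. x + c * x div n) ` {1..n-1} \<inter> (\<lambda>j. j + n * j div c) ` {1..c-1} = {}"
  proof (safe, goal_cases)
    case (1 _ x j)
    have "c * x \<noteq> n * j"
      using not_dvd_mult_coprime[of c n x] assms 1 by auto
    then consider "c * x < n * j" | "n * j < c * x" by linarith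
    then show ?case
      using neq[of c n x j] neq[of n c j x] assms 1 by cases metis+
  qed
  show inj': "inj_on (\<lambda>x. x + c * x div n) {1..n-1}" using inj assms by blast
  \<comment> \<open>Inclusion and equal cardinality: the two disjoint injective images contain (n -
    1) + (c - 1) indices.\<close>
  show "(\<lambda>x. x + c * x div n) ` {1..n-1} \<union> (\<lambda>j. j + n * j div c) ` {1..c-1} = {1..c+n-2}"
  proof (rule card_subset_eq)
    show "(\<lambda>x. x + c * x div n) ` {1..n-1} \<union> (\<lambda>j. j + n * j div c) ` {1..c-1} \<subseteq> {1..c+n-2}"
      using sub[of c n] sub[of n c] assms by (simp add: add.commute)
    have "card ((\<lambda>x. x + c * x div n) ` {1..n-1} \<union> (\<lambda>j. j + n * j div c) ` {1..c-1}) =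
        card {1..n-1} + card {1..c-1}"
      using disj inj[of c n] inj[of n c] assms by (simp add: card_Un_disjoint card_image)
    also have "\<dots> = card {1..c+n-2}" using assms by simp
    finally show "card ((\<lambda>x. x + c * x div n) ` {1..n-1} \<union> (\<lambda>j. j + n * j div c) ` {1..c-1}) =
        card {1..c+n-2}" .
  qed simp
qed

text \<open>By \<open>merge_multiples\<close> the two sums together run through the signs of 1, ...,
  c + n - 2, each once; this range has odd length and starts with an odd number, so -1
  remains.\<close>

lemma hardy_sum_reciprocity_pos:
  assumes cop: "coprime c n" and odd: "odd (c + n)" and "c > 0" "n > 0"
  shows "hardy_sum c n + hardy_sum n c = - 1"
proof -
  have cop': "coprime n c" using cop by (simp add: coprime_commute)
  have "hardy_sum c n + hardy_sum n c =
      sum parity_sign ((\<lambda>x. x + c * x div n) ` {1..n-1}) +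
      sum parity_sign ((\<lambda>j. j + n * j div c) ` {1..c-1})"
    using assms merge_multiples(3)[OF cop] merge_multiples(3)[OF cop']
    by (simp add: hardy_sum_def sum.reindex)
  also have "\<dots> = sum parity_sign {1..c+n-2}"
    using assms merge_multiples(1,2)[OF cop]
    by (subst sum.union_disjoint[symmetric]) auto
  also have "\<dots> = - 1" using assms by (simp add: sum_parity_sign)
  finally show ?thesis .
qed

lemma hardy_sum_reciprocity:
  assumes "coprime c n" "odd (c + n)" "c \<noteq> 0" "n \<noteq> 0"
  shows "hardy_sum c n + hardy_sum n c = - sgn (of_int (c * n))"
proof (rule reciprocity_extend_signs[where P = "\<lambda>c n. coprime c n \<and> odd (c + n)" and
        f = "\<lambda>c n. hardy_sum c n + hardy_sum n c" and
        g = "\<lambda>c n. - sgn (of_int (c * n))"])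
  fix c n :: int
  assume "coprime c n \<and> odd (c + n)" "c > 0" "n > 0"
  then show "hardy_sum c n + hardy_sum n c = - sgn (of_int (c * n))"
    by (simp add: hardy_sum_reciprocity_pos)
qed (use assms in \<open>simp_all add: hardy_sum_minus coprime_commute sgn_minus\<close>)

section \<open>Repunits and the sums at powers of their base\<close>

definition repunit :: "int \<Rightarrow> nat \<Rightarrow> int" where
  "repunit a k = (\<Sum>i<k. a ^ i)"

lemma power_eq_repunit: "a ^ k = (a - 1) * repunit a k + 1"
  using power_diff_1_eq[of a k] by (simp add: repunit_def)

lemma repunit_add: "repunit a (k + l) = repunit a k + a ^ k * repunit a l"
  by (induction l) (simp_all add: repunit_def power_add algebra_simps)

lemma coprime_power_repunit: "coprime (a ^ k) (repunit a k)"
proof (rule coprimeI)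
  fix e assume "e dvd a ^ k" "e dvd repunit a k"
  then have "e dvd a ^ k - (a - 1) * repunit a k" by simp
  then show "is_unit e" by (simp add: power_eq_repunit)
qed

text \<open>Data for one nontrivial power \<open>a ^ k\<close>. Positivity is imposed on
  \<open>p\<close> alone: \<open>a\<close>, and with it \<open>a ^ k\<close> or
  \<open>repunit a k\<close>, may be negative.\<close>

locale repunit_modulus =
  fixes a p :: int and d k :: nat
  assumes a: "a \<notin> {-1, 0, 1}" and k: "0 < k" "k < d"
    and p: "p = repunit a d" "p > 0"
begin

abbreviation c :: int where "c \<equiv> a ^ k"
abbreviation q :: int where "q \<equiv> repunit a k"
abbreviation r :: int where "r \<equiv> repunit a (d - k)"

text \<open>The geometric sum of \<open>d\<close> terms, split after the first
  \<open>k\<close>.\<close>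

lemma p_eq: "p = q + c * r"
  using k p repunit_add[of a k "d - k"] by simp

lemma c_eq: "c = (a - 1) * q + 1"
  by (rule power_eq_repunit)

lemma c_nonzero: "c \<noteq> 0"
  using a by simp

lemma q_nonzero: "q \<noteq> 0"
proof
  assume "q = 0"
  then have "\<bar>a\<bar> ^ k = 1" using c_eq by (simp flip: power_abs)
  moreover have "\<bar>a\<bar> ^ k > 1" using a k by (intro one_less_power) auto
  ultimately show False by simp
qed

lemma coprime_q: "coprime c q" "coprime q c"
  using coprime_power_repunit[of a k] by (simp_all add: coprime_commute)

text \<open>\<open>a ^ d\<close> is coprime to \<open>p = repunit a d\<close> and has
  \<open>c\<close> as a factor.\<close>

lemma coprime_p: "coprime c p" "coprime p c"
proof -
  have "coprime (c * a ^ (d - k)) p"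
    using k p coprime_power_repunit[of a d] by (simp flip: power_add)
  then show "coprime c p" by simp
  then show "coprime p c" by (simp add: coprime_commute)
qed

lemma cong_p_q: "[p = q] (mod c)"
  by (simp add: p_eq cong_iff_dvd_diff)

lemma cong_c_1: "[c = 1] (mod q)"
  by (simp add: c_eq cong_iff_dvd_diff)

text \<open>This makes the signs in the reciprocity laws independent of the sign of \<open>a\<close>.\<close>

lemma sgn_c_q: "sgn (real_of_int c) + sgn (of_int q) - sgn (of_int (q * c)) = 1"
proof -
  have "c > 0 \<or> q > 0"
  proof (rule ccontr)
    assume "\<not> ?thesis"
    then have "c < 0" "q < 0" using c_nonzero q_nonzero by linarith+
    moreover from this have "a < 0" using zero_le_power[of a k] by linarith
    ultimately show False using c_eq mult_neg_neg[of "a - 1" q] by linarith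
  qed
  moreover have "1 + y - y * 1 = 1" "x + 1 - 1 * x = 1" for x y :: real by simp_all
  ultimately show ?thesis
    unfolding of_int_mult sgn_mult by (metis of_int_0_less_iff sgn_pos)
qed

text \<open>A Euclidean algorithm of two steps: reciprocity takes the pair (c, p) to (q, c), since p
  = q modulo c, and then to (1, q), since c = 1 modulo q, where the sum is known.\<close>

lemma dedekind_sum_power:
  "12 * dedekind_sum c p =
    of_int (q + r) - of_int (a + 2) + of_int (a ^ k + a ^ (d - k)) / of_int p"
proof -
  \<comment> \<open>\<open>a ^ (d - k)\<close> inverts \<open>c\<close> modulo \<open>p\<close>;
    this relation later resolves \<open>1 / (C * P)\<close> into partial fractions and is the origin
    of the term \<open>a ^ (d - k) / p\<close>.\<close>
  have e: "c * a ^ (d - k) = (a - 1) * p + 1"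
    using k p power_eq_repunit[of a d] by (simp flip: power_add)
  define A P C Q R E where "A = real_of_int a" and "P = real_of_int p" and "C = real_of_int c"
    and "Q = real_of_int q" and "R = real_of_int r" and "E = real_of_int (a ^ (d - k))"
  have nz: "C \<noteq> 0" "Q \<noteq> 0" "P \<noteq> 0"
    using c_nonzero q_nonzero p by (auto simp: C_def Q_def P_def simp del: of_int_power)
  have C: "C = (A - 1) * Q + 1" 
    unfolding C_def A_def Q_def by (subst c_eq) simp
  have E: "C * E = (A - 1) * P + 1"
    unfolding C_def E_def A_def P_def of_int_mult[symmetric] e by simp
  have P: "P = Q + C * R"
    unfolding C_def P_def Q_def R_def by (subst p_eq) simp
  have "12 * (dedekind_sum c p + dedekind_sum p c) = - 3 * sgn C + C / P + P / C + 1 / (C * P)"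
    using dedekind_reciprocity[OF coprime_p(1) c_nonzero] p
    by (simp add: C_def P_def sgn_mult)
  moreover have "dedekind_sum p c = dedekind_sum q c"
    by (rule dedekind_sum_cong[OF cong_p_q])
  moreover have "12 * (dedekind_sum q c + dedekind_sum c q) =
      - 3 * sgn (Q * C) + Q / C + C / Q + 1 / (Q * C)"
    using dedekind_reciprocity[OF coprime_q(2) q_nonzero c_nonzero]
    by (simp add: C_def Q_def)
  moreover have "12 * dedekind_sum c q = Q + 2 / Q - 3 * sgn Q"
    using dedekind_sum_1'[OF q_nonzero] dedekind_sum_cong[OF cong_c_1] by (simp add: Q_def)
  moreover have "sgn C + sgn Q - sgn (Q * C) = 1"
    using sgn_c_q by (simp add: C_def Q_def)
  \<comment> \<open>The next four identities bring all fractions to the single denominators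
    \<open>C\<close>, \<open>Q\<close> and \<open>P\<close>; those over \<open>C\<close> and
    \<open>Q\<close> then cancel by linear arithmetic.\<close>
  moreover have "P / C = Q / C + R" using nz by (simp add: P field_simps)
  moreover have "C / Q = A - 1 + 1 / Q" using nz by (simp add: C field_simps)
  moreover have "1 / (Q * C) = 1 / Q - (A - 1) / C"
    using nz by (simp add: divide_simps) (simp add: C)
  moreover have "1 / (C * P) = E / P - (A - 1) / C"
    using nz E by (simp add: divide_simps mult.commute)
  ultimately have "12 * dedekind_sum c p = Q + R - (A + 2) + C / P + E / P"
    by argo
  then show ?thesis
    by (simp add: Q_def R_def A_def C_def E_def P_def add_divide_distrib)
qed

text \<open>The same descent, with \<open>alternating_sawtooth_sum\<close> at modulus
  \<open>c\<close> as intermediary. It ends at modulus \<open>q\<close>, where for odd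
  \<open>a\<close> every floor is even and every sign is 1.\<close>

lemma floor_sign_sum_power:
  assumes "odd a"
  shows "floor_sign_sum c p = of_int (q + r) - 1"
proof -
  have odd: "odd c" using assms by simp
  define P C Q R where "P = real_of_int p" and "C = real_of_int c"
    and "Q = real_of_int q" and "R = real_of_int r"
  have nz: "C \<noteq> 0" "Q \<noteq> 0"
    using c_nonzero q_nonzero by (auto simp: C_def Q_def simp del: of_int_power)
  have P: "P = Q + C * R"
    unfolding C_def P_def Q_def R_def by (subst p_eq) simp
  have "floor_sign_sum c q = sgn Q * (\<Sum>x=1..\<bar>q\<bar>-1. 1)"
    unfolding floor_sign_sum_def Q_def
  proof (intro arg_cong2[where f = "(*)"] refl sum.cong)
    fix x assume x: "x \<in> {1..\<bar>q\<bar> - 1}"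
    \<comment> \<open>Since \<open>c = 1\<close> modulo \<open>q\<close> and
      \<open>0 < x < \<bar>q\<bar>\<close>, the remainder is \<open>x\<close> itself and the
      quotient is a multiple of the even number \<open>a - 1\<close>.\<close>
    have "c * x = x + ((a - 1) * sgn q * x) * \<bar>q\<bar>"
      by (subst c_eq) (simp add: algebra_simps abs_sgn)
    also have "\<dots> div \<bar>q\<bar> = (a - 1) * sgn q * x"
      using x by (subst div_mult_self1) auto
    finally show "parity_sign (c * x div \<bar>q\<bar>) = 1" using assms by simp
  qed
  then have "floor_sign_sum c q = Q - sgn Q"
    using q_nonzero by (simp add: Q_def sgn_if split: if_splits)
  moreover have "floor_sign_sum c q = Q / C - sgn (Q * C) + 2 * alternating_sawtooth_sum q c"
    using floor_sign_sum_reciprocity[OF coprime_q(1) odd c_nonzero q_nonzero]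
    by (simp add: C_def Q_def mult.commute)
  moreover have "floor_sign_sum c p = P / C - sgn C + 2 * alternating_sawtooth_sum p c"
    using floor_sign_sum_reciprocity[OF coprime_p(1) odd c_nonzero] p
    by (simp add: C_def P_def sgn_mult)
  moreover have "alternating_sawtooth_sum p c = alternating_sawtooth_sum q c"
    by (rule alternating_sawtooth_sum_cong[OF cong_p_q])
  moreover have "sgn C + sgn Q - sgn (Q * C) = 1"
    using sgn_c_q by (simp add: C_def Q_def)
  moreover have "P / C = Q / C + R" using nz by (simp add: P field_simps)
  ultimately have "floor_sign_sum c p = Q + R - 1" by linarith
  then show ?thesis by (simp add: Q_def R_def)
qed

text \<open>Here \<open>c\<close> is even while \<open>p\<close>, \<open>q\<close>, \<open>r\<close>
  are odd. Hardy reciprocity passes to modulus \<open>c\<close>, where replacing \<open>p\<close> by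
  \<open>q\<close> absorbs the sign (-1)^x; the floor-sign law with odd first argument
  \<open>q\<close> then leads to the explicit value of
  \<open>alternating_sawtooth_sum 1 q\<close>.\<close>

lemma hardy_sum_power:
  assumes "even a"
  shows "hardy_sum c p = - of_int a"
proof -
  have odd: "odd (repunit a l)" if "l > 0" for l
  proof
    assume "even (repunit a l)"
    then have "odd (a ^ l)" using power_eq_repunit[of a l] by simp
    with that assms show False by simp
  qed
  have even: "even c" using assms k by simp
  have odd': "odd q" "odd r" "odd p" using odd k p by auto
  define A C Q where "A = real_of_int a" and "C = real_of_int c" and "Q = real_of_int q"
  have nz: "C \<noteq> 0" "Q \<noteq> 0"
    using c_nonzero q_nonzero by (auto simp: C_def Q_def simp del: of_int_power)
  have C: "C = (A - 1) * Q + 1"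
    unfolding C_def A_def Q_def by (subst c_eq) simp
  have "alternating_sawtooth_sum 1 q =
      sgn Q * (\<Sum>x=1..\<bar>q\<bar>-1. parity_sign x * of_int x / of_int \<bar>q\<bar> - parity_sign x / 2)"
    unfolding alternating_sawtooth_sum_def Q_def
    by (intro arg_cong2[where f = "(*)"] refl sum.cong) (auto simp: sawtooth_eq algebra_simps)
  also have "\<dots> = sgn Q * ((\<bar>Q\<bar> - 1) / (2 * \<bar>Q\<bar>))"
  proof -
    have "(\<Sum>x=1..\<bar>q\<bar>-1. parity_sign x * of_int x) =
        (parity_sign (\<bar>q\<bar> - 1) * (2 * of_int (\<bar>q\<bar> - 1) + 1) - 1) / 4"
      using q_nonzero by (intro sum_parity_sign) simp
    also have "\<dots> = (\<bar>Q\<bar> - 1) / 2" using odd' by (simp add: Q_def field_simps)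
    finally have "(\<Sum>x=1..\<bar>q\<bar>-1. parity_sign x * of_int x) = (\<bar>Q\<bar> - 1) / 2" .
    moreover have "(\<Sum>x=1..\<bar>q\<bar>-1. parity_sign x) = 0"
      using q_nonzero odd' by (simp add: sum_parity_sign)
    ultimately show ?thesis
      by (simp only: sum_subtractf sum_divide_distrib[symmetric]) (simp add: Q_def)
  qed
  also have "\<dots> = (sgn Q - 1 / Q) / 2"
    using nz by (simp add: sgn_if field_simps)
  finally have "2 * alternating_sawtooth_sum 1 q = sgn Q - 1 / Q" by simp
  moreover have "alternating_sawtooth_sum c q = alternating_sawtooth_sum 1 q"
    by (rule alternating_sawtooth_sum_cong[OF cong_c_1])
  moreover have "floor_sign_sum q c = C / Q - sgn (Q * C) + 2 * alternating_sawtooth_sum c q"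
    using floor_sign_sum_reciprocity[OF coprime_q(2) odd'(1) q_nonzero c_nonzero]
    by (simp add: C_def Q_def)
  moreover have "C / Q = A - 1 + 1 / Q" using nz by (simp add: C field_simps)
  \<comment> \<open>Passing from \<open>p = q + c * r\<close> to \<open>q\<close> shifts the floor
    by \<open>sgn c * r * x\<close>. As \<open>r\<close> is odd, this has the parity of
    \<open>x\<close> and cancels the extra sign of \<open>hardy_sum\<close>.\<close>
  moreover have "hardy_sum p c = floor_sign_sum q c"
    unfolding hardy_sum_def floor_sign_sum_def
  proof (intro arg_cong2[where f = "(*)"] refl sum.cong)
    fix x
    have "(sgn c * r * x) * \<bar>c\<bar> = (sgn c * \<bar>c\<bar>) * r * x"
      by (simp only: mult_ac)
    then have "p * x = q * x + (sgn c * r * x) * \<bar>c\<bar>"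
      by (simp only: p_eq sgn_mult_abs ring_distribs)
    also have "\<dots> div \<bar>c\<bar> = sgn c * r * x + q * x div \<bar>c\<bar>"
      using c_nonzero by (subst div_mult_self1) auto
    finally have "x + p * x div \<bar>c\<bar> = (1 + sgn c * r) * x + q * x div \<bar>c\<bar>"
      by (simp add: algebra_simps)
    moreover have "even (1 + sgn c * r)" using odd' c_nonzero by (simp add: sgn_if)
    ultimately show "parity_sign (x + p * x div \<bar>c\<bar>) = parity_sign (q * x div \<bar>c\<bar>)"
      by (simp add: parity_sign_add)
  qed
  moreover have "hardy_sum c p + hardy_sum p c = - sgn C"
    using hardy_sum_reciprocity[OF coprime_p(1) _ c_nonzero] even odd' p
    by (simp add: C_def sgn_mult)
  moreover have "sgn C + sgn Q - sgn (Q * C) = 1"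
    using sgn_c_q by (simp add: C_def Q_def)
  ultimately show ?thesis by (simp add: A_def)
qed

end

section \<open>Finite Fourier analysis\<close>

definition unit_root :: "int \<Rightarrow> int \<Rightarrow> complex" where
  "unit_root n t = cis (2 * pi * of_int t / of_int n)"

lemma unit_root_add: "unit_root n (s + t) = unit_root n s * unit_root n t"
  by (simp add: unit_root_def cis_mult add_divide_distrib ring_distribs)

lemma unit_root_power: "unit_root n (t * int k) = unit_root n t ^ k"
  unfolding unit_root_def Complex.DeMoivre by (rule arg_cong[where f = cis]) (simp add: mult_ac)

lemma cnj_unit_root: "cnj (unit_root n t) = unit_root n (- t)"
  by (simp add: unit_root_def cis_cnj)

lemma unit_root_eq_1_iff:
  assumes "n \<noteq> 0"
  shows "unit_root n t = 1 \<longleftrightarrow> n dvd t"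
proof -
  have "unit_root n t = 1 \<longleftrightarrow> (\<exists>m::int. 2 * pi * of_int t / of_int n = of_int (2 * m) * pi)"
    unfolding unit_root_def cis_conv_exp by (subst exp_eq_1) simp
  also have "\<dots> \<longleftrightarrow> (\<exists>m::int. real_of_int t = of_int (n * m))"
    using assms by (intro arg_cong[where f = Ex] ext) (auto simp: field_simps)
  finally show ?thesis unfolding of_int_eq_iff dvd_def .
qed

lemma unit_root_power_eq_1: "n > 0 \<Longrightarrow> unit_root n t ^ nat n = 1"
  using unit_root_eq_1_iff[of n "t * int (nat n)"] by (simp add: unit_root_power[symmetric])

lemma sum_int_eq_sum_nat:
  fixes n :: int
  assumes "n > 0"
  shows "(\<Sum>x=0..n-1. f x) = (\<Sum>k<nat n. f (int k))"
proof (rule sum.reindex_bij_witness[where j = nat and i = int])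
qed (use assms in auto)

lemma sum_unit_root:
  assumes "n > 0"
  shows "(\<Sum>k=0..n-1. unit_root n (t * k)) = (if n dvd t then of_int n else 0)"
proof -
  have "(\<Sum>k=0..n-1. unit_root n (t * k)) = (\<Sum>k<nat n. unit_root n t ^ k)"
    using assms by (simp add: sum_int_eq_sum_nat unit_root_power)
  also have "\<dots> = (if n dvd t then of_int n else 0)"
  proof (cases "n dvd t")
    case True
    then have "unit_root n t = 1" using assms by (simp add: unit_root_eq_1_iff)
    with True assms show ?thesis by simp
  next
    case False
    then show ?thesis
      using assms by (simp add: geometric_sum unit_root_eq_1_iff unit_root_power_eq_1)
  qed
  finally show ?thesis .
qed

text \<open>For an \<open>n\<close>-th root of unity \<open>z\<close> other than 1 this gives
  \<open>n / (z - 1)\<close> for the sum of \<open>k * z ^ k\<close>, the transform of the linear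
  part of the sawtooth.\<close>

lemma sum_arith_geometric:
  fixes z :: "'a :: comm_ring_1"
  shows "(z - 1) * (\<Sum>k<n. of_nat k * z ^ k) = of_nat n * z ^ n - z * (\<Sum>k<n. z ^ k)"
  by (induction n) (simp_all add: algebra_simps)

lemma sum_from_0:
  fixes n :: int and f :: "int \<Rightarrow> 'a :: comm_monoid_add"
  assumes "n > 0"
  shows "(\<Sum>x=0..n-1. f x) = f 0 + (\<Sum>x=1..n-1. f x)"
proof -
  have "{0..n - 1} = insert 0 {1..n - 1}" using assms by auto
  then show ?thesis by simp
qed

text \<open>Multiplying the transform at \<open>k\<close> by the conjugate of the transform at
  \<open>h * k\<close> and summing over \<open>k\<close> leaves, by orthogonality, the pairs with
  \<open>x = h * y\<close> modulo \<open>n\<close>. The constant \<open>c\<close> is split off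
  because the transforms in question are purely imaginary.\<close>

lemma parseval_dilated:
  fixes f g :: "int \<Rightarrow> real" and c :: complex
  assumes "n > 0" and mod: "\<And>x. f (x mod n) = f x"
    and hat: "\<And>k. (\<Sum>x=0..n-1. of_real (f x) * unit_root n (k * x)) = c * of_real (g k)"
  shows "(cmod c)\<^sup>2 * (\<Sum>k=0..n-1. g k * g (h * k)) = n * (\<Sum>x=0..n-1. f x * f (h * x))"
proof -
  have "complex_of_real ((cmod c)\<^sup>2 * (\<Sum>k=0..n-1. g k * g (h * k))) =
      (\<Sum>k=0..n-1. (c * g k) * cnj (c * g (h * k)))"
    unfolding of_real_mult of_real_sum complex_norm_square sum_distrib_left
    by (intro sum.cong refl) simp
  also have "\<dots> = (\<Sum>k=0..n-1. \<Sum>x=0..n-1. \<Sum>y=0..n-1.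
      f x * f y * unit_root n ((x - h * y) * k))"
  proof (rule sum.cong[OF refl])
    fix k
    have "unit_root n ((x - h * y) * k) = unit_root n (k * x) * cnj (unit_root n (h * k * y))" for x y
      unfolding cnj_unit_root unit_root_add[symmetric]
      by (rule arg_cong[where f = "unit_root n"]) (simp add: algebra_simps)
    then show "(c * g k) * cnj (c * g (h * k)) =
        (\<Sum>x=0..n-1. \<Sum>y=0..n-1. f x * f y * unit_root n ((x - h * y) * k))"
      unfolding hat[of k, symmetric] hat[of "h * k", symmetric] cnj_sum sum_product
      by (simp add: mult_ac)
  qed
  also have "\<dots> = (\<Sum>x=0..n-1. \<Sum>y=0..n-1. \<Sum>k=0..n-1.
      f x * f y * unit_root n ((x - h * y) * k))"
    by (subst sum.swap, rule sum.cong[OF refl], subst sum.swap) (rule refl)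
  also have "\<dots> = (\<Sum>x=0..n-1. \<Sum>y=0..n-1. of_real (f x * f y * (if n dvd x - h * y then n else 0)))"
    using assms(1)
    by (intro sum.cong refl) (auto simp: sum_distrib_left[symmetric] sum_unit_root)
  also have "\<dots> = (\<Sum>y=0..n-1. \<Sum>x=0..n-1. of_real (f x * f y * (if n dvd x - h * y then n else 0)))"
    by (rule sum.swap)
  also have "\<dots> = (\<Sum>y=0..n-1. of_real (n * (f y * f (h * y))))"
  proof (rule sum.cong[OF refl])
    fix y
    have "(n dvd x - h * y) \<longleftrightarrow> x = h * y mod n" if "x \<in> {0..n - 1}" for x
      using that by (simp add: mod_eq_dvd_iff[symmetric])
    then have "(\<Sum>x=0..n-1. f x * f y * real_of_int (if n dvd x - h * y then n else 0)) =
        (\<Sum>x=0..n-1. if x = h * y mod n then n * (f y * f (h * y)) else 0)"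
      by (intro sum.cong refl) (auto simp: mod)
    also have "\<dots> = n * (f y * f (h * y))"
      using assms(1) by (simp add: sum.delta)
    finally show "(\<Sum>x=0..n-1. complex_of_real (f x * f y * (if n dvd x - h * y then n else 0))) =
        of_real (n * (f y * f (h * y)))"
      unfolding of_real_sum[symmetric] of_real_eq_iff .
  qed
  also have "\<dots> = of_real (n * (\<Sum>x=0..n-1. f x * f (h * x)))"
    by (simp add: sum_distrib_left)
  finally show ?thesis unfolding of_real_eq_iff .
qed

section \<open>Transforms giving cotangents and tangents\<close>

lemma sin_pi_multiple:
  assumes "n dvd k" "n \<noteq> 0"
  shows "sin (pi * of_int k / of_int n) = 0"
proof -
  obtain m where "k = n * m" using assms by auto
  then have "pi * of_int k / of_int n = of_int m * pi" using assms by simp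
  then show ?thesis by (simp add: sin_zero_iff_int2)
qed

lemma cis_plus_minus_inverse:
  "cis t + inverse (cis t) = 2 * of_real (cos t)"
  "cis t - inverse (cis t) = 2 * \<i> * of_real (sin t)"
  by (simp_all add: complex_eq_iff)

text \<open>The arithmetic-geometric sum becomes \<open>(z + 1) / (2 * (z - 1))\<close>; with
  \<open>z = w ^ 2\<close>, division of both parts by \<open>w\<close> turns it into cosine over
  sine of half the angle.\<close>

lemma sawtooth_fourier:
  assumes "n > 0"
  shows "(\<Sum>x=0..n-1. sawtooth n x * unit_root n (k * x)) =
    - (\<i> / 2) * of_real (cot (pi * of_int k / of_int n))"
proof (cases "n dvd k")
  case True
  have "(\<Sum>x=0..n-1. sawtooth n x * unit_root n (k * x)) = (\<Sum>x=1..n-1. of_real (sawtooth n x))"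
    using assms True by (simp add: sum_from_0 unit_root_eq_1_iff[THEN iffD2] sawtooth_def[of n 0])
  also have "\<dots> = 0"
    using assms sum_sawtooth[of n] by (simp flip: of_real_sum)
  \<comment> \<open>The cotangent has a pole here; the convention for division by zero gives it the
    value 0, in agreement with the vanishing sum.\<close>
  finally show ?thesis
    using True assms by (simp add: cot_def sin_pi_multiple)
next
  case False
  define z where "z = unit_root n k"
  define w where "w = cis (pi * of_int k / of_int n)"
  define N where "N = nat n"
  have n: "n = int N" "N > 0" using assms by (simp_all add: N_def)
  have z1: "z \<noteq> 1" using False assms by (simp add: z_def unit_root_eq_1_iff)
  have zN: "z ^ N = 1" using assms by (simp add: z_def N_def unit_root_power_eq_1)
  have zw: "z = w ^ 2"
    unfolding z_def w_def unit_root_def Complex.DeMoivre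
    by (rule arg_cong[where f = cis]) simp
  have w0: "w \<noteq> 0" by (simp add: w_def)
  have geo: "(\<Sum>x<N. z ^ x) = 0" using z1 zN by (simp add: geometric_sum)
  have "(\<Sum>x=0..n-1. sawtooth n x * unit_root n (k * x)) =
      (\<Sum>x=1..n-1. (of_int x / of_int n - 1 / 2) * unit_root n (k * x))"
    using assms by (simp add: sum_from_0) (simp add: sawtooth_def[of n 0] sawtooth_eq)
  \<comment> \<open>The linear expression would contribute -1/2 at \<open>x = 0\<close>, where the
    sawtooth is 0.\<close>
  also have "\<dots> = 1 / 2 + (\<Sum>x=0..n-1. (of_int x / of_int n - 1 / 2) * unit_root n (k * x))"
    using assms by (simp add: sum_from_0 unit_root_def)
  also have "(\<Sum>x=0..n-1. (of_int x / of_int n - 1 / 2) * unit_root n (k * x)) =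
      (\<Sum>x<N. of_nat x * z ^ x / of_nat N - z ^ x / 2)"
    using assms n by (simp add: sum_int_eq_sum_nat z_def unit_root_power algebra_simps)
  also have "\<dots> = (\<Sum>x<N. of_nat x * z ^ x) / of_nat N"
    by (simp add: sum_subtractf sum_divide_distrib[symmetric] geo)
  also have "(\<Sum>x<N. of_nat x * z ^ x) = of_nat N / (z - 1)"
    using sum_arith_geometric[of z N] z1 by (simp add: geo zN field_simps)
  also have "1 / 2 + of_nat N / (z - 1) / of_nat N = (z + 1) / (2 * (z - 1))"
    using z1 n by (simp add: field_simps)
  also have "\<dots> = (w + inverse w) / (2 * (w - inverse w))"
    using w0 z1 by (simp add: zw divide_simps power2_eq_square)
  also have "\<dots> = - (\<i> / 2) * of_real (cot (pi * of_int k / of_int n))"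
    unfolding w_def cis_plus_minus_inverse cot_def by (simp add: divide_simps)
  finally show ?thesis .
qed

text \<open>A geometric sum with ratio \<open>- z\<close>. Oddness of \<open>n\<close> gives
  \<open>(- z) ^ n = - 1\<close> and excludes \<open>z = - 1\<close>, so the tangent meets no
  pole.\<close>

lemma parity_sign_fourier:
  assumes "n > 0" "odd n"
  shows "(\<Sum>x=0..n-1. of_real (if n dvd x then 0 else parity_sign (x mod n)) * unit_root n (k * x)) =
    - \<i> * of_real (tan (pi * of_int k / of_int n))"
proof -
  define z where "z = unit_root n k"
  define w where "w = cis (pi * of_int k / of_int n)"
  define N where "N = nat n"
  have n: "n = int N" "N > 0" "odd N" using assms by (simp_all add: N_def even_nat_iff)
  have zN: "z ^ N = 1" using assms by (simp add: z_def N_def unit_root_power_eq_1)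
  have z1: "- z \<noteq> 1"
  proof
    assume "- z = 1"
    then have "z ^ N = (- 1) ^ N" by (metis minus_minus)
    with zN n show False by simp
  qed
  then have z2: "1 + z \<noteq> 0" by (metis add_eq_0_iff minus_minus)
  have zw: "z = w ^ 2"
    unfolding z_def w_def unit_root_def Complex.DeMoivre
    by (rule arg_cong[where f = cis]) simp
  have w0: "w \<noteq> 0" by (simp add: w_def)
  have "(\<Sum>x=0..n-1. of_real (if n dvd x then 0 else parity_sign (x mod n)) * unit_root n (k * x)) =
      (\<Sum>x=1..n-1. of_real (parity_sign x) * unit_root n (k * x))"
    using assms zdvd_not_zless[of _ n] by (simp add: sum_from_0)
  also have "\<dots> = (\<Sum>x=0..n-1. of_real (parity_sign x) * unit_root n (k * x)) - 1"
    using assms by (simp add: sum_from_0 unit_root_def)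
  also have "(\<Sum>x=0..n-1. of_real (parity_sign x) * unit_root n (k * x)) = (\<Sum>x<N. (- z) ^ x)"
    using assms n unfolding sum_int_eq_sum_nat[OF assms(1)] N_def[symmetric] z_def unit_root_power
    by (intro sum.cong refl) (auto simp: parity_sign_def power_minus[of "unit_root _ _"])
  also have "\<dots> = ((- z) ^ N - 1) / (- z - 1)" using z1 by (simp add: geometric_sum)
  also have "(- z) ^ N = - 1" using n zN by simp
  also have "(- 1 - 1) / (- z - 1) - 1 = (1 - z) / (1 + z)"
    using z1 z2 by (simp add: divide_simps) (simp add: algebra_simps)
  also have "\<dots> = - (w - inverse w) / (w + inverse w)"
    using w0 z1 z2 by (simp add: zw divide_simps power2_eq_square add_eq_0_iff)
  also have "\<dots> = - \<i> * of_real (tan (pi * of_int k / of_int n))"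
    unfolding w_def cis_plus_minus_inverse tan_def by simp
  finally show ?thesis .
qed

text \<open>Parseval with a constant of modulus 1/2, whence the factor 4; at \<open>x = 0\<close>
  both sides contribute 0.\<close>

lemma sum_cot_cot:
  assumes "n > 0"
  shows "(\<Sum>x=1..n-1. cot (pi * of_int x / of_int n) * cot (pi * of_int (h * x) / of_int n)) =
    4 * of_int n * dedekind_sum h n"
proof -
  have "(cmod (- (\<i> / 2)))\<^sup>2 * (\<Sum>x=0..n-1. cot (pi * of_int x / of_int n) *
      cot (pi * of_int (h * x) / of_int n)) = n * (\<Sum>x=0..n-1. sawtooth n x * sawtooth n (h * x))"
    by (rule parseval_dilated[OF assms _ sawtooth_fourier[OF assms]]) simp
  moreover have "sawtooth n 0 = 0" by (simp add: sawtooth_def)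
  moreover have "cmod (- (\<i> / 2)) = 1 / 2" by (simp add: norm_divide)
  ultimately show ?thesis
    using assms by (simp add: sum_from_0 dedekind_sum_def power2_eq_square)
qed

lemma sum_tan_tan:
  assumes "n > 0" "odd n" "coprime h n"
  shows "(\<Sum>x=1..n-1. tan (pi * of_int x / of_int n) * tan (pi * of_int (h * x) / of_int n)) =
    of_int n * (if odd h then floor_sign_sum h n else hardy_sum h n)"
proof -
  define D where "D = (\<lambda>x. if n dvd x then 0 else parity_sign (x mod n))"
  have "(cmod (- \<i>))\<^sup>2 * (\<Sum>x=0..n-1. tan (pi * of_int x / of_int n) *
      tan (pi * of_int (h * x) / of_int n)) = n * (\<Sum>x=0..n-1. D x * D (h * x))"
    unfolding D_def
    by (rule parseval_dilated[OF assms(1) _ parity_sign_fourier[OF assms(1,2)]])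
       (simp add: dvd_mod_iff)
  moreover have "D 0 = 0" by (simp add: D_def)
  moreover have "D x * D (h * x) =
      (if odd h then parity_sign (h * x div n) else parity_sign (x + h * x div n))"
    if x: "x \<in> {1..n - 1}" for x
  proof -
    have "D x = parity_sign x" using x zdvd_not_zless[of x n] by (simp add: D_def)
    moreover have "D (h * x) = parity_sign (h * x mod n)"
      using x not_dvd_mult_coprime[of h n x] assms(3) by (simp add: D_def)
    \<comment> \<open>As \<open>n\<close> is odd, remainder and quotient of \<open>h * x\<close>
      have parities adding up to that of \<open>h * x\<close>. For odd \<open>h\<close> the sign of
      \<open>h * x\<close> cancels that of \<open>x\<close>; for even \<open>h\<close> it is
      1.\<close>
    moreover have "even (h * x mod n) \<longleftrightarrow> even (h * x + h * x div n)"
    proof -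
      have "h * x + h * x div n = h * x mod n + (n + 1) * (h * x div n)"
        by (simp add: algebra_simps)
      then show ?thesis using assms(2) by simp
    qed
    ultimately show ?thesis by (auto simp: parity_sign_def)
  qed
  ultimately show ?thesis
    using assms by (simp add: sum_from_0 floor_sign_sum_def hardy_sum_def)
qed

section \<open>The value at 1 of an odd periodic Dirichlet series\<close>

text \<open>A partial sum differs from one over whole blocks by fewer than \<open>m\<close> terms.
  In \<open>g\<close> these are padded to exactly \<open>m\<close> summands, so that a finite sum of
  null sequences results.\<close>

lemma sums_of_block_sums:
  fixes f :: "nat \<Rightarrow> 'a :: real_normed_vector"
  assumes m: "m > 0" and f: "f \<longlonglongrightarrow> 0" and L: "(\<lambda>K. \<Sum>i<K * m. f i) \<longlonglongrightarrow> L"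
  shows "f sums L"
proof -
  define g where "g = (\<lambda>N. \<Sum>j<m. if j < N mod m then f (N div m * m + j) else 0)"
  have div: "filterlim (\<lambda>N. N div m) at_top at_top"
    using m by (intro filterlim_at_top_div_const_nat)
  have "g \<longlonglongrightarrow> (\<Sum>j<m. 0)"
    unfolding g_def
  proof (intro tendsto_sum)
    fix j
    have "filterlim (\<lambda>N. N div m * m + j) at_top at_top"
      using m by (intro filterlim_at_top_mono[OF div]) (auto simp: eventually_at_top_linorder
          intro!: exI[of _ 0] trans_le_add1)
    then have "(\<lambda>N. norm (f (N div m * m + j))) \<longlonglongrightarrow> 0"
      using filterlim_compose[OF f] tendsto_norm_zero by blast
    then show "(\<lambda>N. if j < N mod m then f (N div m * m + j) else 0) \<longlonglongrightarrow> 0"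
      by (rule Lim_null_comparison[rotated]) auto
  qed
  moreover have "(\<lambda>N. \<Sum>i<N div m * m. f i) \<longlonglongrightarrow> L"
    using filterlim_compose[OF L div] .
  ultimately have "(\<lambda>N. (\<Sum>i<N div m * m. f i) + g N) \<longlonglongrightarrow> L"
    using tendsto_add by fastforce
  also have "(\<lambda>N. (\<Sum>i<N div m * m. f i) + g N) = (\<lambda>N. \<Sum>i<N. f i)"
  proof
    fix N
    have "g N = (\<Sum>j<N mod m. f (N div m * m + j))"
    proof -
      have "{..<N mod m} = {j \<in> {..<m}. j < N mod m}"
        using m less_trans[OF _ mod_less_divisor[OF m]] by auto
      then show ?thesis by (simp only: g_def sum.inter_filter[OF finite_lessThan])
    qed
    also have "\<dots> = (\<Sum>i\<in>{N div m * m..<N div m * m + N mod m}. f i)"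
      using sum.shift_bounds_nat_ivl[of f 0 "N div m * m" "N mod m"]
      by (simp only: lessThan_atLeast0 add_0 add.commute)
    finally show "(\<Sum>i<N div m * m. f i) + g N = (\<Sum>i<N. f i)"
      using sum.atLeastLessThan_concat[of 0 "N div m * m" N f]
      by (simp add: lessThan_atLeast0 div_mult_mod_eq)
  qed
  finally show ?thesis by (simp only: sums_def)
qed

text \<open>The logarithmic derivative of the reflection formula for \<open>Gamma\<close>: both
  forms of the product are differentiated and the nonzero common factor is cancelled.\<close>

lemma Digamma_reflection_complex:
  fixes z :: complex
  assumes "z \<notin> \<int>"
  shows "Digamma (1 - z) - Digamma z = of_real pi * cot (of_real pi * z)"
proof -
  have z': "1 - z \<notin> \<int>" using assms Ints_diff[of 1 "1 - z"] by auto
  then have nonpos: "z \<notin> \<int>\<^sub>\<le>\<^sub>0" "1 - z \<notin> \<int>\<^sub>\<le>\<^sub>0"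
    using assms nonpos_Ints_subset_Ints by auto
  have sin: "sin (of_real pi * z) \<noteq> 0"
    using assms by (subst sin_eq_0) auto
  have "((\<lambda>z. Gamma z * Gamma (1 - z)) has_field_derivative
      Gamma z * Gamma (1 - z) * (Digamma z - Digamma (1 - z))) (at z)"
    using nonpos by (auto intro!: derivative_eq_intros simp: algebra_simps)
  then have "((\<lambda>z. of_real pi / sin (of_real pi * z)) has_field_derivative
      of_real pi / sin (of_real pi * z) * (Digamma z - Digamma (1 - z))) (at z)"
    unfolding Gamma_reflection_complex .
  moreover have "((\<lambda>z. of_real pi / sin (of_real pi * z)) has_field_derivative
      - (of_real pi / sin (of_real pi * z) * (of_real pi * cot (of_real pi * z)))) (at z)"
    using sin by (auto intro!: derivative_eq_intros simp: cot_def power2_eq_square)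
  ultimately have "of_real pi / sin (of_real pi * z) * (Digamma z - Digamma (1 - z)) =
      of_real pi / sin (of_real pi * z) * - (of_real pi * cot (of_real pi * z))"
    using DERIV_unique by fastforce
  then have "Digamma z - Digamma (1 - z) = - (of_real pi * cot (of_real pi * z))"
    using sin by (subst (asm) mult_left_cancel) auto
  then show ?thesis by (simp add: algebra_simps)
qed

text \<open>The limits defining the two digamma values carry the same logarithm, which cancels in
  the difference.\<close>

lemma cot_partial_fractions:
  fixes z :: complex
  assumes "z \<notin> \<int>"
  shows "(\<lambda>K. \<Sum>k<K. inverse (z + of_nat k) - inverse (1 - z + of_nat k))
    \<longlonglongrightarrow> of_real pi * cot (of_real pi * z)"
proof -
  have "z \<noteq> 0" "1 - z \<noteq> 0" using assms by auto
  from tendsto_diff[OF Digamma_LIMSEQ[OF this(2)] Digamma_LIMSEQ[OF this(1)]]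
  show ?thesis by (simp add: Digamma_reflection_complex[OF assms] sum_subtractf)
qed

lemma periodic_mod_int:
  fixes f :: "int \<Rightarrow> 'a"
  assumes "\<And>x. f (x + n) = f x"
  shows "f (x mod n) = f x"
proof -
  have mult: "f (y + n * k) = f y" for y k
  proof (induction k rule: int_induct[where k = 0])
    case (step1 i)
    then show ?case using assms[of "y + n * i"] by (simp add: algebra_simps)
  next
    case (step2 i)
    then show ?case using assms[of "y + n * (i - 1)"] by (simp add: algebra_simps)
  qed simp
  show ?thesis using mult[of "x mod n" "x div n"] by simp
qed

text \<open>Summation over whole periods groups the series by residues. Each \<open>h K x\<close>
  alone diverges with \<open>K\<close>; averaging \<open>x\<close> with \<open>n - x\<close>,
  oddness leaves differences that converge to cotangents.\<close>

lemma L_one_odd_periodic: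
  fixes \<psi> :: "int \<Rightarrow> complex"
  assumes n: "n > 0" and period: "\<And>x. \<psi> (x + int n) = \<psi> x" and odd: "\<And>x. \<psi> (- x) = - \<psi> x"
  shows "L_one \<psi> = of_real (pi / (2 * real n)) *
    (\<Sum>x=1..int n-1. \<psi> x * of_real (cot (pi * of_int x / real n)))"
proof -
  define f where "f = (\<lambda>i. \<psi> (int (Suc i)) / of_nat (Suc i))"
  define h where "h = (\<lambda>K x. \<Sum>k<K. inverse (of_int x / of_nat n + of_nat k :: complex))"
  have mod: "\<psi> (x mod int n) = \<psi> x" for x by (rule periodic_mod_int) (rule period)
  have \<psi>n: "\<psi> (int n) = 0" using mod[of "int n"] odd[of 0] by simp
  have reflect: "\<psi> (int n - x) = - \<psi> x" for x using period[of "- x"] odd[of x] by simp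
  have f0: "f \<longlonglongrightarrow> 0"
  proof (rule Lim_null_comparison)
    have "norm (\<psi> x) \<le> (\<Sum>y=0..int n-1. norm (\<psi> y))" for x
      using n member_le_sum[of "x mod int n" "{0..int n - 1}" "\<lambda>y. norm (\<psi> y)"] by (simp add: mod)
    then show "\<forall>\<^sub>F i in sequentially. norm (f i) \<le> (\<Sum>y=0..int n-1. norm (\<psi> y)) * inverse (real (Suc i))"
      by (intro always_eventually allI) (simp add: f_def norm_divide field_simps del: of_nat_Suc)
    show "(\<lambda>i. (\<Sum>y=0..int n-1. norm (\<psi> y)) * inverse (real (Suc i))) \<longlonglongrightarrow> 0"
      using tendsto_mult_left[OF LIMSEQ_inverse_real_of_nat] by fastforce
  qed
  have block: "(\<Sum>i<K * n. f i) =
      1 / (2 * of_nat n) * (\<Sum>x=1..int n-1. \<psi> x * (h K x - h K (int n - x)))" for K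
  proof -
    have "(\<Sum>i<K * n. f i) = (\<Sum>k<K. \<Sum>i=k * n..<k * n + n. f i)"
      by (rule sum.nat_group[symmetric])
    also have "\<dots> = (\<Sum>k<K. \<Sum>x=1..int n. \<psi> x / of_int (x + int (k * n)))"
    proof (rule sum.cong[OF refl])
      fix k
      define s where "s = k * n"
      have "(\<Sum>i=s..<s + n. f i) = (\<Sum>x=1..int n. \<psi> x / of_int (x + int s))"
      proof (rule sum.reindex_bij_witness[where j = "\<lambda>i. int i + 1 - int s"
            and i = "\<lambda>x. nat (x - 1 + int s)"])
        fix i assume i: "i \<in> {s..<s + n}"
        have "\<psi> (int (Suc i)) = \<psi> (int i + 1 - int s)"
          using mod[of "int (Suc i)"] mod[of "int i + 1 - int s"]
            mod_mult_self1[of "int i + 1 - int s" "int k" "int n"] by (simp add: s_def add_ac)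
        then show "\<psi> (int i + 1 - int s) / of_int (int i + 1 - int s + int s) = f i"
          by (simp add: f_def add.commute)
      qed auto
      then show "(\<Sum>i=k * n..<k * n + n. f i) = (\<Sum>x=1..int n. \<psi> x / of_int (x + int (k * n)))"
        by (simp only: s_def)
    qed
    also have "\<dots> = (\<Sum>x=1..int n. \<Sum>k<K. \<psi> x / of_int (x + int (k * n)))"
      by (rule sum.swap)
    also have "\<dots> = (\<Sum>x=1..int n. 1 / of_nat n * (\<psi> x * h K x))"
      unfolding h_def sum_distrib_left using n
      by (intro sum.cong refl) (simp add: field_simps)
    also have "\<dots> = 1 / of_nat n * (\<Sum>x=1..int n-1. \<psi> x * h K x)"
    proof -
      have "{1..int n} = insert (int n) {1..int n - 1}" using n by auto
      then show ?thesis by (simp add: \<psi>n sum_distrib_left)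
    qed
    \<comment> \<open>Doubling prepares the reflection: one of the two copies is reindexed by
      \<open>n - x\<close>.\<close>
    also have "(\<Sum>x=1..int n-1. \<psi> x * h K x) =
        1 / 2 * ((\<Sum>x=1..int n-1. \<psi> x * h K x) + (\<Sum>x=1..int n-1. \<psi> x * h K x))"
      by simp
    also have "(\<Sum>x=1..int n-1. \<psi> x * h K x) + (\<Sum>x=1..int n-1. \<psi> x * h K x) =
        (\<Sum>x=1..int n-1. \<psi> x * h K x) + (\<Sum>x=1..int n-1. \<psi> (int n - x) * h K (int n - x))"
      by (rule arg_cong2[where f = "(+)"], rule refl,
          rule sum.reindex_bij_witness[where j = "\<lambda>x. int n - x" and i = "\<lambda>x. int n - x"]) auto
    also have "\<dots> = (\<Sum>x=1..int n-1. \<psi> x * (h K x - h K (int n - x)))"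
      unfolding sum.distrib[symmetric] by (intro sum.cong refl) (simp add: reflect algebra_simps)
    finally show ?thesis by simp
  qed
  have "(\<lambda>K. h K x - h K (int n - x)) \<longlonglongrightarrow> of_real (pi * cot (pi * of_int x / real n))"
    if x: "x \<in> {1..int n - 1}" for x
  proof -
    define z :: complex where "z = of_int x / of_nat n"
    have z: "z = of_real (of_int x / real n)" by (simp add: z_def)
    have "z \<notin> \<int>"
    proof
      assume "z \<in> \<int>"
      then obtain m where "z = of_int m" by (auto elim: Ints_cases)
      then have "complex_of_int x = of_int (m * int n)"
        using n by (simp add: z_def field_simps)
      then have "x = m * int n" by (simp only: of_int_eq_iff)
      then show False using x zdvd_not_zless[of x "int n"] by auto
    qed
    have cot: "of_real pi * cot (of_real pi * z) = of_real (pi * cot (pi * of_int x / real n))"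
      unfolding z of_real_mult[symmetric] cot_of_real[symmetric] by simp
    from cot_partial_fractions[OF \<open>z \<notin> \<int>\<close>] have
      "(\<lambda>K. \<Sum>k<K. inverse (z + of_nat k) - inverse (1 - z + of_nat k))
        \<longlonglongrightarrow> of_real (pi * cot (pi * of_int x / real n))"
      unfolding cot .
    moreover have "h K (int n - x) = (\<Sum>k<K. inverse (1 - z + of_nat k))" for K
      using n by (simp add: h_def z_def diff_divide_distrib)
    ultimately show ?thesis by (simp add: h_def z_def sum_subtractf)
  qed
  then have "(\<lambda>K. \<Sum>i<K * n. f i) \<longlonglongrightarrow> 1 / (2 * of_nat n) *
      (\<Sum>x=1..int n-1. \<psi> x * of_real (pi * cot (pi * of_int x / real n)))"
    unfolding block by (intro tendsto_intros)
  from sums_of_block_sums[OF n f0 this] have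
    "L_one \<psi> = 1 / (2 * of_nat n) *
      (\<Sum>x=1..int n-1. \<psi> x * of_real (pi * cot (pi * of_int x / real n)))"
    unfolding L_one_def f_def by (rule sums_unique[symmetric])
  also have "\<dots> = of_real (pi / (2 * real n)) *
      (\<Sum>x=1..int n-1. \<psi> x * of_real (cot (pi * of_int x / real n)))"
    by (simp add: sum_distrib_left mult_ac)
  finally show ?thesis .
qed

section \<open>Orthogonality of odd characters\<close>

lemma dirichlet_character_mod:
  assumes "dirichlet_character p \<psi>"
  shows "\<psi> (x mod int p) = \<psi> x"
  using assms by (intro periodic_mod_int) (simp add: dirichlet_character_def)

lemma dirichlet_character_cong:
  assumes "dirichlet_character p \<psi>" "[x = y] (mod int p)"
  shows "\<psi> x = \<psi> y"
  using dirichlet_character_mod[OF assms(1)] assms(2) by (metis Cong.cong_def)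

lemma dirichlet_character_1:
  assumes "dirichlet_character p \<psi>"
  shows "\<psi> 1 = 1"
proof -
  have "\<psi> (1 * 1) = \<psi> 1 * \<psi> 1" "\<psi> 1 \<noteq> 0"
    using assms unfolding dirichlet_character_def by (blast, simp)
  then show ?thesis by simp
qed

lemma dirichlet_character_power:
  assumes "dirichlet_character p \<psi>"
  shows "\<psi> (x ^ k) = \<psi> x ^ k"
  using assms by (induction k) (simp_all add: dirichlet_character_1, simp add: dirichlet_character_def)

lemma odd_character_minus:
  assumes "\<psi> \<in> odd_characters p H"
  shows "\<psi> (- x) = - \<psi> x"
proof -
  have "\<psi> (- 1 * x) = \<psi> (- 1) * \<psi> x"
    using assms unfolding odd_characters_def dirichlet_character_def by blast
  then show ?thesis using assms by (simp add: odd_characters_def)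
qed

lemma power_cong_exponent:
  fixes z :: "'a :: monoid_mult"
  assumes "z ^ n = 1" "[i = j] (mod n)"
  shows "z ^ i = z ^ j"
proof -
  have "z ^ i = z ^ (i mod n)" for i
    using assms(1) by (metis div_mult_mod_eq mult.commute mult_1 power_add power_mult power_one)
  then show ?thesis using assms(2) by (metis Cong.cong_def)
qed

text \<open>If \<open>m\<close> does not divide \<open>i\<close>, multiplication by a primitive
  \<open>m\<close>-th root of unity permutes the roots and scales the sum by a factor other than 1,
  so the sum is 0.\<close>

lemma sum_roots_of_minus_1:
  assumes "m > 0"
  shows "(\<Sum>\<zeta>::complex | \<zeta> ^ m = - 1. \<zeta> ^ i) = (if m dvd i then of_nat m * (- 1) ^ (i div m) else 0)"
proof (cases "m dvd i")
  case True
  then obtain l where l: "i = m * l" ..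
  have "(\<Sum>\<zeta>::complex | \<zeta> ^ m = - 1. \<zeta> ^ i) = (\<Sum>\<zeta>::complex | \<zeta> ^ m = - 1. (- 1) ^ l)"
    by (intro sum.cong refl) (simp add: l power_mult)
  also have "\<dots> = of_nat m * (- 1) ^ l" using assms by (simp add: card_nth_roots)
  finally show ?thesis using l assms by simp
next
  case False
  define \<omega> where "\<omega> = unit_root (int m) 1"
  have \<omega>: "\<omega> ^ k = 1 \<longleftrightarrow> m dvd k" for k
    using unit_root_power[of "int m" 1 k] unit_root_eq_1_iff[of "int m" "int k"] assms
    by (simp add: \<omega>_def)
  have "\<omega> \<noteq> 0" by (simp add: \<omega>_def unit_root_def)
  have "(\<Sum>\<zeta>::complex | \<zeta> ^ m = - 1. \<zeta> ^ i) = (\<Sum>\<zeta>::complex | \<zeta> ^ m = - 1. (\<omega> * \<zeta>) ^ i)"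
    using \<omega>[of m] \<open>\<omega> \<noteq> 0\<close>
    by (intro sum.reindex_bij_witness[where i = "\<lambda>\<zeta>. \<omega> * \<zeta>" and j = "\<lambda>\<zeta>. \<zeta> / \<omega>"])
       (auto simp: power_mult_distrib power_divide)
  also have "\<dots> = \<omega> ^ i * (\<Sum>\<zeta>::complex | \<zeta> ^ m = - 1. \<zeta> ^ i)"
    by (simp add: power_mult_distrib sum_distrib_left)
  finally have "(1 - \<omega> ^ i) * (\<Sum>\<zeta>::complex | \<zeta> ^ m = - 1. \<zeta> ^ i) = 0"
    by (simp add: algebra_simps)
  with \<omega>[of i] False show ?thesis by simp
qed

section \<open>Odd characters parametrised by the roots of -1\<close>

text \<open>\<open>H\<close> has index \<open>2 * m\<close> in the cyclic unit group. It is
  described by its size and its exponent, which determine it there.\<close>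

locale odd_order_subgroup =
  fixes p d m :: nat and H :: "int set"
  assumes prime: "prime p" and p_eq: "p = 2 * m * d + 1" and odd_d: "odd d"
    and H_subset: "H \<subseteq> {1..int p - 1}" and card_H: "card H = d"
    and H_power: "\<And>h. h \<in> H \<Longrightarrow> [h ^ d = 1] (mod int p)"
begin

lemma pos: "m > 0" "d > 0" "p > 2"
proof -
  have "m * d > 0" using prime_gt_1_nat[OF prime] p_eq by (cases "m * d = 0") auto
  then show "m > 0" "d > 0" by auto
  have "p = 2 * (m * d) + 1" using p_eq by (simp only: mult.assoc)
  with \<open>m * d > 0\<close> show "p > 2" by linarith
qed

lemma odd_p: "odd p"
  using p_eq by simp

definition g :: nat where "g = (SOME g. residue_primroot p g)"

lemma primroot: "residue_primroot p g"
  unfolding g_def by (rule someI_ex, rule prime_primitive_root_exists[OF prime_gt_1_nat[OF prime] prime])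

lemma ord_g: "ord p g = 2 * m * d"
  using primroot p_eq totient_prime[OF prime] by (simp add: residue_primroot_def)

lemma coprime_g: "coprime p g"
  using primroot by (simp add: residue_primroot_def)

lemma cong_power_g_iff: "[int g ^ i = int g ^ j] (mod int p) \<longleftrightarrow> [i = j] (mod 2 * m * d)"
  using order_divides_expdiff[OF coprime_g, of i j] cong_int_iff[of "g ^ i" "g ^ j" p]
  by (simp add: ord_g)

lemma power_g_exists:
  assumes "\<not> int p dvd x"
  shows "\<exists>i < 2 * m * d. [x = int g ^ i] (mod int p)"
proof -
  have "nat (x mod int p) \<in> totatives p"
  proof -
    have "x mod int p \<noteq> 0" using assms by (simp add: dvd_eq_mod_eq_0)
    moreover have "0 \<le> x mod int p" "x mod int p < int p" using pos by auto
    ultimately have "0 < nat (x mod int p)" "nat (x mod int p) < p" by auto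
    then show ?thesis
      using prime by (simp add: totatives_prime)
  qed
  then obtain i where i: "i < totient p" "nat (x mod int p) = g ^ i mod p"
    using residue_primroot_is_generator[OF _ primroot] pos by (auto simp: bij_betw_def)
  have "x mod int p = int (nat (x mod int p))" using pos by simp
  also have "\<dots> = int g ^ i mod int p" unfolding i(2) by (simp add: of_nat_mod)
  finally have "[x = int g ^ i] (mod int p)" by (simp add: Cong.cong_def)
  then show ?thesis using i(1) p_eq totient_prime[OF prime] by auto
qed

text \<open>A square root of 1 modulo a prime, different from 1 because \<open>g\<close> has order
  \<open>2 * m * d\<close>.\<close>

lemma power_g_half: "[int g ^ (m * d) = - 1] (mod int p)"
proof -
  have "[(int g ^ (m * d)) ^ 2 = 1] (mod int p)"
    using cong_power_g_iff[of "2 * m * d" 0] by (simp add: power_mult[symmetric] mult_ac cong_0_iff)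
  then have "int p dvd (int g ^ (m * d) - 1) * (int g ^ (m * d) + 1)"
    by (simp add: cong_iff_dvd_diff power2_eq_square algebra_simps)
  moreover have "\<not> int p dvd int g ^ (m * d) - 1"
    using cong_power_g_iff[of "m * d" 0] pos
    by (simp add: cong_iff_dvd_diff[symmetric] cong_0_iff nat_dvd_not_less)
  ultimately show ?thesis
    using prime by (auto simp: prime_dvd_mult_iff cong_iff_dvd_diff)
qed

text \<open>\<open>h ^ d = 1\<close> forces the exponent of \<open>h\<close> to be a multiple of
  \<open>2 * m\<close>; at most \<open>d\<close> residues are of this form, and \<open>H\<close> has
  \<open>d\<close> elements.\<close>

lemma H_eq: "H = (\<lambda>l. int g ^ (2 * m * l) mod int p) ` {..<d}"
proof (rule card_subset_eq)
  show "H \<subseteq> (\<lambda>l. int g ^ (2 * m * l) mod int p) ` {..<d}"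
  proof
    fix h assume h: "h \<in> H"
    then have h': "h mod int p = h" "\<not> int p dvd h" using H_subset zdvd_not_zless[of h "int p"] by auto
    then obtain i where i: "i < 2 * m * d" "[h = int g ^ i] (mod int p)"
      using power_g_exists by blast
    have "[int g ^ (i * d) = int g ^ 0] (mod int p)"
      using cong_trans[OF cong_sym[OF cong_pow[OF i(2), of d]] H_power[OF h]]
      by (simp add: power_mult)
    then have "2 * m * d dvd i * d" unfolding cong_power_g_iff cong_0_iff .
    then have "2 * m dvd i" using pos by simp
    then obtain l where l: "i = 2 * m * l" ..
    with i(1) have "l < d" by simp
    moreover have "h = int g ^ (2 * m * l) mod int p"
      using i(2) h'(1) by (simp add: l Cong.cong_def)
    ultimately show "h \<in> (\<lambda>l. int g ^ (2 * m * l) mod int p) ` {..<d}" by blast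
  qed
  then show "card H = card ((\<lambda>l. int g ^ (2 * m * l) mod int p) ` {..<d})"
    using card_mono[of "(\<lambda>l. int g ^ (2 * m * l) mod int p) ` {..<d}" H]
      card_image_le[of "{..<d}" "\<lambda>l. int g ^ (2 * m * l) mod int p"] card_H by simp
qed simp

lemma mem_H_iff:
  assumes "[x = int g ^ i] (mod int p)"
  shows "x mod int p \<in> H \<longleftrightarrow> 2 * m dvd i"
proof
  assume "x mod int p \<in> H"
  then obtain l where "x mod int p = int g ^ (2 * m * l) mod int p" unfolding H_eq by blast
  then have "[int g ^ i = int g ^ (2 * m * l)] (mod int p)"
    using assms by (simp add: Cong.cong_def)
  then have "[i = 2 * m * l] (mod 2 * m * d)" unfolding cong_power_g_iff .
  then have "[i = 2 * m * l] (mod 2 * m)" by (rule cong_modulus_mult_nat)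
  then show "2 * m dvd i" using cong_dvd_iff by fastforce
next
  assume "2 * m dvd i"
  then obtain l where l: "i = 2 * m * l" ..
  have "[i = 2 * m * (l mod d)] (mod 2 * m * d)"
    unfolding l Cong.cong_def by (simp add: mult_mod_right[symmetric])
  then have "x mod int p = int g ^ (2 * m * (l mod d)) mod int p"
    using cong_trans[OF assms] cong_power_g_iff by (simp add: Cong.cong_def)
  then show "x mod int p \<in> H"
    unfolding H_eq using pos by auto
qed

text \<open>The character sending \<open>g\<close> to \<open>\<zeta>\<close>; which discrete
  logarithm of \<open>x\<close> is chosen is immaterial once \<open>\<zeta> ^ m = - 1\<close>,
  because then \<open>\<zeta> ^ (2 * m * d) = 1\<close>.\<close>

definition char_of_root :: "complex \<Rightarrow> int \<Rightarrow> complex" where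
  "char_of_root \<zeta> x =
    (if int p dvd x then 0 else \<zeta> ^ (SOME i. [x = int g ^ i] (mod int p)))"

lemma char_of_root_eq:
  assumes "\<zeta> ^ m = - 1" "[x = int g ^ i] (mod int p)"
  shows "char_of_root \<zeta> x = \<zeta> ^ i"
proof -
  define j where "j = (SOME j. [x = int g ^ j] (mod int p))"
  have "[x = int g ^ j] (mod int p)" unfolding j_def by (rule someI) fact
  then have "[j = i] (mod 2 * m * d)"
    using assms(2) cong_power_g_iff cong_sym cong_trans by blast
  moreover have "\<zeta> ^ (2 * m * d) = ((\<zeta> ^ m) ^ 2) ^ d"
    by (simp only: power_mult[symmetric] mult_ac)
  then have "\<zeta> ^ (2 * m * d) = 1" using assms(1) by simp
  ultimately have "\<zeta> ^ j = \<zeta> ^ i" by (intro power_cong_exponent)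
  moreover have "\<not> int p dvd x"
  proof
    assume "int p dvd x"
    then have "int p dvd int (g ^ i)" using assms(2) cong_dvd_iff[of x "int g ^ i" "int p"]
      by (simp add: cong_dvd_iff cong_sym)
    then have "p dvd g ^ i" by (simp only: of_nat_dvd_iff)
    moreover have "coprime p (g ^ i)" using coprime_g by simp
    ultimately have "is_unit p" by (meson coprime_common_divisor dvd_refl)
    then show False using pos by simp
  qed
  ultimately show ?thesis by (simp add: char_of_root_def j_def)
qed

lemma coprime_iff: "coprime x (int p) \<longleftrightarrow> \<not> int p dvd x"
  using prime_imp_coprime[of "int p" x] prime pos
  by (auto simp: coprime_commute coprime_absorb_left)

lemma char_of_root_in_odd_characters:
  assumes "\<zeta> ^ m = - 1"
  shows "char_of_root \<zeta> \<in> odd_characters p H"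
proof -
  have "char_of_root \<zeta> (x * y) = char_of_root \<zeta> x * char_of_root \<zeta> y" for x y
  proof (cases "int p dvd x * y")
    case True
    then have "int p dvd x \<or> int p dvd y" using prime by (simp add: prime_dvd_mult_iff)
    with True show ?thesis by (auto simp: char_of_root_def)
  next
    case False
    then have "\<not> int p dvd x" "\<not> int p dvd y" by auto
    then obtain i j where ij: "[x = int g ^ i] (mod int p)" "[y = int g ^ j] (mod int p)"
      using power_g_exists by blast
    have "[x * y = int g ^ (i + j)] (mod int p)"
      using cong_mult[OF ij] by (simp add: power_add)
    from char_of_root_eq[OF assms this] show ?thesis
      using assms ij by (simp add: char_of_root_eq power_add)
  qed
  moreover have "char_of_root \<zeta> (x + int p) = char_of_root \<zeta> x" for x
    by (simp add: char_of_root_def Cong.cong_def)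
  moreover have "char_of_root \<zeta> x \<noteq> 0 \<longleftrightarrow> coprime x (int p)" for x
  proof -
    have "\<zeta> \<noteq> 0" using assms pos by (auto simp: power_0_left)
    then show ?thesis by (simp add: char_of_root_def coprime_iff)
  qed
  moreover have "char_of_root \<zeta> (- 1) = - 1"
    using char_of_root_eq[OF assms cong_sym[OF power_g_half]] assms odd_d by (simp add: power_mult)
  moreover have "char_of_root \<zeta> h = 1" if h: "h \<in> H" for h
  proof -
    have h': "h mod int p = h" "\<not> int p dvd h"
      using h H_subset zdvd_not_zless[of h "int p"] by auto
    then obtain i where i: "[h = int g ^ i] (mod int p)" using power_g_exists by blast
    then obtain l where "i = 2 * m * l" using mem_H_iff[OF i] h h' by (auto elim: dvdE)
    then have "\<zeta> ^ i = ((\<zeta> ^ m) ^ 2) ^ l" by (simp add: power_mult[symmetric] mult_ac)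
    then show ?thesis using char_of_root_eq[OF assms i] assms by simp
  qed
  ultimately show ?thesis by (simp add: odd_characters_def dirichlet_character_def)
qed

lemma bij_betw_char_of_root:
  "bij_betw char_of_root {\<zeta>. \<zeta> ^ m = - 1} (odd_characters p H)"
proof (rule bij_betw_byWitness[where f' = "\<lambda>\<psi>. \<psi> (int g)"])
  show "\<forall>\<zeta>\<in>{\<zeta>. \<zeta> ^ m = - 1}. char_of_root \<zeta> (int g) = \<zeta>"
    using char_of_root_eq[of _ "int g" 1] by simp
  \<comment> \<open>Triviality on \<open>H\<close> gives the value 1 at \<open>g ^ (2 * m)\<close>,
    so the \<open>m\<close>-th power is 1 or -1; the value 1 would contradict oddness at
    \<open>g ^ (m * d) = - 1\<close>.\<close>
  have root: "\<psi> (int g) ^ m = - 1" if \<psi>: "\<psi> \<in> odd_characters p H" for \<psi>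
  proof -
    have dc: "dirichlet_character p \<psi>" using \<psi> by (simp add: odd_characters_def)
    have "int g ^ (2 * m) mod int p \<in> H" by (subst mem_H_iff[of _ "2 * m"]) auto
    then have "\<psi> (int g ^ (2 * m)) = 1"
      using \<psi> dirichlet_character_mod[OF dc, of "int g ^ (2 * m)"] by (simp add: odd_characters_def)
    then have "(\<psi> (int g) ^ m) ^ 2 = 1"
      by (simp add: dirichlet_character_power[OF dc] power_mult[symmetric] mult.commute)
    then have "\<psi> (int g) ^ m = 1 \<or> \<psi> (int g) ^ m = - 1" by (simp add: power2_eq_1_iff)
    moreover have "(\<psi> (int g) ^ m) ^ d = - 1"
      using dirichlet_character_cong[OF dc power_g_half] \<psi>
      by (simp add: dirichlet_character_power[OF dc] power_mult odd_characters_def)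
    ultimately show ?thesis by auto
  qed
  then show "(\<lambda>\<psi>. \<psi> (int g)) ` odd_characters p H \<subseteq> {\<zeta>. \<zeta> ^ m = - 1}" by auto
  show "\<forall>\<psi>\<in>odd_characters p H. char_of_root (\<psi> (int g)) = \<psi>"
  proof (intro ballI ext)
    fix \<psi> x assume \<psi>: "\<psi> \<in> odd_characters p H"
    have dc: "dirichlet_character p \<psi>" using \<psi> by (simp add: odd_characters_def)
    show "char_of_root (\<psi> (int g)) x = \<psi> x"
    proof (cases "int p dvd x")
      case True
      then have "\<psi> x = 0" using dc coprime_iff[of x] by (auto simp: dirichlet_character_def)
      with True show ?thesis by (simp add: char_of_root_def)
    next
      case False
      then obtain i where i: "[x = int g ^ i] (mod int p)" using power_g_exists by blast
      show ?thesis
        using char_of_root_eq[OF root[OF \<psi>] i] dirichlet_character_cong[OF dc i]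
        by (simp add: dirichlet_character_power[OF dc])
    qed
  qed
  show "char_of_root ` {\<zeta>. \<zeta> ^ m = - 1} \<subseteq> odd_characters p H"
    using char_of_root_in_odd_characters by auto
qed

lemma card_odd_characters: "card (odd_characters p H) = m"
  using bij_betw_same_card[OF bij_betw_char_of_root] card_nth_roots[of "- 1" m] pos by simp

text \<open>With \<open>z = g ^ i\<close> this is a power sum over the roots of -1. If
  \<open>m\<close> divides \<open>i\<close>, the parity of \<open>i div m\<close> tells whether
  \<open>z\<close> or \<open>- z\<close> lies in \<open>H\<close>, exactly one of them as
  \<open>d\<close> is odd; otherwise neither does.\<close>

lemma sum_odd_characters:
  assumes "\<not> int p dvd z"
  shows "(\<Sum>\<psi>\<in>odd_characters p H. \<psi> z) =
    of_nat m * (of_bool (z mod int p \<in> H) - of_bool (- z mod int p \<in> H))"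
proof -
  obtain i where i: "[z = int g ^ i] (mod int p)" using power_g_exists[OF assms] by blast
  have "[- z = int g ^ (i + m * d)] (mod int p)"
    using cong_mult[OF i cong_sym[OF power_g_half]] by (simp add: power_add)
  then have minus: "- z mod int p \<in> H \<longleftrightarrow> 2 * m dvd i + m * d" by (rule mem_H_iff)
  have "(\<Sum>\<psi>\<in>odd_characters p H. \<psi> z) = (\<Sum>\<zeta> | \<zeta> ^ m = - 1. char_of_root \<zeta> z)"
    by (rule sum.reindex_bij_betw[OF bij_betw_char_of_root, symmetric])
  also have "\<dots> = (\<Sum>\<zeta>::complex | \<zeta> ^ m = - 1. \<zeta> ^ i)"
    by (intro sum.cong refl) (simp add: char_of_root_eq[OF _ i])
  also have "\<dots> = (if m dvd i then of_nat m * (- 1) ^ (i div m) else 0)"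
    using pos by (intro sum_roots_of_minus_1)
  also have "\<dots> = of_nat m * (of_bool (2 * m dvd i) - of_bool (2 * m dvd i + m * d))"
  proof (cases "m dvd i")
    case True
    then obtain l where l: "i = m * l" ..
    have dvd: "2 * m dvd m * k \<longleftrightarrow> even k" for k using pos by (simp add: mult.commute)
    have "2 * m dvd i \<longleftrightarrow> even l" using dvd l by simp
    moreover have "2 * m dvd i + m * d \<longleftrightarrow> even (l + d)"
      using dvd[of "l + d"] l by (simp add: distrib_left)
    ultimately show ?thesis using odd_d pos by (simp add: l)
  next
    case False
    then have "\<not> 2 * m dvd i" "\<not> 2 * m dvd i + m * d"
      using dvd_mult_right dvd_add_left_iff[of m "m * d" i] by (blast, metis dvd_mult_right dvd_triv_left)
    with False show ?thesis by simp
  qed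
  finally show ?thesis by (simp add: mem_H_iff[OF i] minus)
qed

text \<open>Fermat's little theorem makes the value a root of unity.\<close>

lemma cmod_odd_character:
  assumes "\<psi> \<in> odd_characters p H" "\<not> int p dvd x"
  shows "cmod (\<psi> x) = 1"
proof -
  have dc: "dirichlet_character p \<psi>" using assms by (simp add: odd_characters_def)
  obtain i where "[x = int g ^ i] (mod int p)" using power_g_exists[OF assms(2)] by blast
  then have "[x ^ (p - 1) = int g ^ (i * (p - 1))] (mod int p)"
    using cong_pow[of x "int g ^ i" "int p" "p - 1"] by (simp only: power_mult)
  also have "[int g ^ (i * (p - 1)) = int g ^ 0] (mod int p)"
    unfolding cong_power_g_iff using p_eq by (simp add: cong_0_iff)
  finally have "[x ^ (p - 1) = 1] (mod int p)" by simp
  then have "\<psi> x ^ (p - 1) = 1"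
    using dirichlet_character_cong[OF dc] dirichlet_character_power[OF dc]
      dirichlet_character_1[OF dc] by metis
  then show ?thesis
    using power_eq_imp_eq_norm[of "\<psi> x" "p - 1" 1] pos by simp
qed

text \<open>The substitution \<open>x = y * z\<close> in the squared modulus turns
  \<open>\<psi> x * cnj (\<psi> y)\<close> into \<open>\<psi> z\<close>, to which orthogonality
  applies. The negative terms, with \<open>- z\<close> in \<open>H\<close>, contribute as much as
  the positive ones because \<open>f\<close> is odd; hence the factor 2.\<close>

lemma sum_norm_square_twisted_sum:
  fixes f :: "int \<Rightarrow> real"
  assumes period: "\<And>x. f (x + int p) = f x" and odd: "\<And>x. f (- x) = - f x"
  shows "(\<Sum>\<psi>\<in>odd_characters p H. (cmod (\<Sum>x=1..int p-1. \<psi> x * of_real (f x)))\<^sup>2) =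
    2 * real m * (\<Sum>h\<in>H. \<Sum>x=1..int p-1. f x * f (h * x))"
proof -
  let ?X = "odd_characters p H" and ?U = "{1..int p - 1}"
  have not_dvd: "\<not> int p dvd x" if "x \<in> ?U" for x using that zdvd_not_zless by auto
  have of_bool: "complex_of_real (of_bool P) = of_bool P" for P by simp
  have f_mod: "f (x mod int p) = f x" for x by (rule periodic_mod_int) (rule period)
  have expand: "of_real ((cmod (\<Sum>x\<in>?U. \<psi> x * of_real (f x)))\<^sup>2) =
      (\<Sum>y\<in>?U. \<Sum>z\<in>?U. of_real (f y * f (z * y)) * \<psi> z)" if \<psi>: "\<psi> \<in> ?X" for \<psi>
  proof -
    have dc: "dirichlet_character p \<psi>" using \<psi> by (simp add: odd_characters_def)
    have "of_real ((cmod (\<Sum>x\<in>?U. \<psi> x * of_real (f x)))\<^sup>2) =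
        (\<Sum>y\<in>?U. cnj (\<psi> y) * of_real (f y) * (\<Sum>x\<in>?U. \<psi> x * of_real (f x)))"
      unfolding complex_norm_square cnj_sum by (subst mult.commute) (simp add: sum_distrib_right)
    also have "\<dots> = (\<Sum>y\<in>?U. \<Sum>z\<in>?U. of_real (f y * f (z * y)) * \<psi> z)"
    proof (rule sum.cong[OF refl])
      fix y assume y: "y \<in> ?U"
      then have cop: "coprime y (int p)" using not_dvd coprime_iff by blast
      have "cmod (\<psi> y) = 1" using cmod_odd_character[OF \<psi> not_dvd[OF y]] .
      then have unit: "cnj (\<psi> y) * \<psi> y = 1"
        by (simp add: mult.commute flip: complex_norm_square)
      have "(\<Sum>x\<in>?U. \<psi> x * of_real (f x)) = (\<Sum>z\<in>?U. \<psi> (y * z) * of_real (f (y * z)))"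
        by (rule sum_mult_mod[OF cop, symmetric]) (simp add: f_mod dirichlet_character_mod[OF dc])
      also have "\<dots> = \<psi> y * (\<Sum>z\<in>?U. \<psi> z * of_real (f (z * y)))"
        using dc by (simp add: dirichlet_character_def sum_distrib_left mult_ac)
      finally have "cnj (\<psi> y) * of_real (f y) * (\<Sum>x\<in>?U. \<psi> x * of_real (f x)) =
          (cnj (\<psi> y) * \<psi> y) * of_real (f y) * (\<Sum>z\<in>?U. \<psi> z * of_real (f (z * y)))"
        by (simp only: mult_ac)
      also have "\<dots> = (\<Sum>z\<in>?U. of_real (f y * f (z * y)) * \<psi> z)"
        unfolding unit by (simp add: sum_distrib_left mult_ac)
      finally show "cnj (\<psi> y) * of_real (f y) * (\<Sum>x\<in>?U. \<psi> x * of_real (f x)) =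
          (\<Sum>z\<in>?U. of_real (f y * f (z * y)) * \<psi> z)" .
    qed
    finally show ?thesis .
  qed
  have "complex_of_real (\<Sum>\<psi>\<in>?X. (cmod (\<Sum>x\<in>?U. \<psi> x * of_real (f x)))\<^sup>2) =
      (\<Sum>\<psi>\<in>?X. \<Sum>y\<in>?U. \<Sum>z\<in>?U. of_real (f y * f (z * y)) * \<psi> z)"
    unfolding of_real_sum by (intro sum.cong refl expand)
  also have "\<dots> = (\<Sum>y\<in>?U. \<Sum>z\<in>?U. \<Sum>\<psi>\<in>?X. of_real (f y * f (z * y)) * \<psi> z)"
    by (subst sum.swap, rule sum.cong[OF refl], rule sum.swap)
  also have "\<dots> = (\<Sum>y\<in>?U. \<Sum>z\<in>?U. of_real (f y * f (z * y)) *
      (of_nat m * (of_bool (z \<in> H) - of_bool (int p - z \<in> H))))"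
  proof (intro sum.cong refl)
    fix y z assume z: "z \<in> ?U"
    then have "- z mod int p = int p - z" "z mod int p = z"
      by (auto simp: zmod_zminus1_eq_if)
    then show "(\<Sum>\<psi>\<in>?X. of_real (f y * f (z * y)) * \<psi> z) = of_real (f y * f (z * y)) *
        (of_nat m * (of_bool (z \<in> H) - of_bool (int p - z \<in> H)))"
      using sum_odd_characters[OF not_dvd[OF z]] by (simp add: sum_distrib_left[symmetric])
  qed
  also have "\<dots> = of_real (real m * (\<Sum>y\<in>?U. (\<Sum>z\<in>?U. f y * f (z * y) * of_bool (z \<in> H)) -
      (\<Sum>z\<in>?U. f y * f (z * y) * of_bool (int p - z \<in> H))))"
    by (simp add: sum_distrib_left sum_subtractf[symmetric] of_bool algebra_simps)
  also have "(\<Sum>y\<in>?U. (\<Sum>z\<in>?U. f y * f (z * y) * of_bool (z \<in> H)) -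
      (\<Sum>z\<in>?U. f y * f (z * y) * of_bool (int p - z \<in> H))) =
      (\<Sum>y\<in>?U. 2 * (\<Sum>h\<in>H. f y * f (h * y)))"
  proof (rule sum.cong[OF refl])
    fix y
    have "(\<Sum>z\<in>?U. f y * f (z * y) * of_bool (int p - z \<in> H)) =
        (\<Sum>z\<in>?U. - (f y * f (z * y) * of_bool (z \<in> H)))"
    proof (rule sum.reindex_bij_witness[where i = "\<lambda>z. int p - z" and j = "\<lambda>z. int p - z"])
      fix z
      have "f ((int p - z) * y) = f (- (z * y))"
        using f_mod[of "(int p - z) * y"] f_mod[of "- (z * y)"]
          mod_mult_self1[of "- (z * y)" y "int p"] by (simp add: algebra_simps)
      then show "- (f y * f ((int p - z) * y) * of_bool (int p - z \<in> H)) =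
          f y * f (z * y) * of_bool (int p - z \<in> H)"
        by (simp add: odd)
    qed auto
    moreover have "(\<Sum>z\<in>?U. f y * f (z * y) * of_bool (z \<in> H)) = (\<Sum>h\<in>H. f y * f (h * y))"
      using H_subset by (intro sum.mono_neutral_cong_right) auto
    ultimately show "(\<Sum>z\<in>?U. f y * f (z * y) * of_bool (z \<in> H)) -
        (\<Sum>z\<in>?U. f y * f (z * y) * of_bool (int p - z \<in> H)) = 2 * (\<Sum>h\<in>H. f y * f (h * y))"
      by (simp add: sum_negf)
  qed
  also have "\<dots> = 2 * (\<Sum>h\<in>H. \<Sum>y\<in>?U. f y * f (h * y))"
    by (subst sum.swap) (simp add: sum_distrib_left)
  finally show ?thesis unfolding of_real_eq_iff by simp
qed

end

section \<open>The mean values\<close>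

context odd_order_subgroup
begin

lemma L_one_odd_character:
  assumes "\<psi> \<in> odd_characters p H"
  shows "L_one \<psi> = of_real (pi / (2 * real p)) *
    (\<Sum>x=1..int p-1. \<psi> x * of_real (cot (pi * of_int x / real p)))"
  using assms pos odd_character_minus[OF assms]
  by (intro L_one_odd_periodic) (auto simp: odd_characters_def dirichlet_character_def)

text \<open>Modulo \<open>p\<close>, the odd residue \<open>2 * z + p\<close> modulo \<open>2 * p\<close> is \<open>2 * z\<close>; the shift by \<open>p\<close> turns the
  cotangent into a tangent.\<close>

lemma L_one_induced_character:
  assumes \<psi>: "\<psi> \<in> odd_characters p H"
  shows "L_one (induced_character (2 * p) \<psi>) = - of_real (pi / (4 * real p)) * \<psi> 2 *
    (\<Sum>x=1..int p-1. \<psi> x * of_real (tan (pi * of_int x / real p)))"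
proof -
  let ?\<psi>' = "induced_character (2 * p) \<psi>"
  have dc: "dirichlet_character p \<psi>" using \<psi> by (simp add: odd_characters_def)
  have zero: "\<psi> x = 0 \<longleftrightarrow> int p dvd x" for x
    using dc coprime_iff[of x] by (auto simp: dirichlet_character_def)
  have induced: "?\<psi>' x = (if odd x then \<psi> x else 0)" for x
  proof -
    have "coprime x (int (2 * p)) \<longleftrightarrow> odd x \<and> \<not> int p dvd x"
      using coprime_iff[of x] by simp
    then show ?thesis using zero[of x] by (auto simp: induced_character_def)
  qed
  have shift: "\<psi> (2 * z + int p) = \<psi> 2 * \<psi> z" "\<psi> (2 * z - int p) = \<psi> 2 * \<psi> z" for z
  proof -
    have "\<psi> (2 * z + int p) = \<psi> (2 * z)" "\<psi> (2 * z - int p) = \<psi> (2 * z)"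
      by (intro dirichlet_character_cong[OF dc]; simp add: cong_iff_dvd_diff)+
    then show "\<psi> (2 * z + int p) = \<psi> 2 * \<psi> z" "\<psi> (2 * z - int p) = \<psi> 2 * \<psi> z"
      using dc by (simp_all add: dirichlet_character_def)
  qed
  have "L_one ?\<psi>' = of_real (pi / (2 * real (2 * p))) *
    (\<Sum>x=1..int (2 * p)-1. ?\<psi>' x * of_real (cot (pi * of_int x / real (2 * p))))"
  proof (rule L_one_odd_periodic)
    fix x
    have "\<psi> (x + int (2 * p)) = \<psi> x"
      by (intro dirichlet_character_cong[OF dc]) (simp add: cong_iff_dvd_diff)
    then show "?\<psi>' (x + int (2 * p)) = ?\<psi>' x" by (simp add: induced)
    show "?\<psi>' (- x) = - ?\<psi>' x" by (simp add: induced odd_character_minus[OF \<psi>])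
  qed (use pos in auto)
  \<comment> \<open>Even \<open>x\<close> and \<open>x = p\<close> are not coprime to
    \<open>2 * p\<close>, so the induced character vanishes there.\<close>
  also have "(\<Sum>x=1..int (2 * p)-1. ?\<psi>' x * of_real (cot (pi * of_int x / real (2 * p)))) =
      (\<Sum>x | x \<in> {1..2 * int p - 1} \<and> odd x \<and> x \<noteq> int p.
        \<psi> x * of_real (cot (pi * of_int x / (2 * real p))))"
    using zero[of "int p"] by (intro sum.mono_neutral_cong_right) (auto simp: induced)
  also have "\<dots> = (\<Sum>z=1..int p-1. - (\<psi> 2 * (\<psi> z * of_real (tan (pi * of_int z / real p)))))"
  \<comment> \<open>Each odd \<open>x\<close> other than \<open>p\<close> in the range is
    \<open>2 * z + p\<close> or \<open>2 * z - p\<close> for exactly one \<open>z\<close> strictly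
    between 0 and \<open>p\<close>; the plus sign belongs to \<open>x > p\<close>.\<close>
  proof (rule sum.reindex_bij_witness[where j = "\<lambda>x. if x > int p then (x - int p) div 2 else (x + int p) div 2"
        and i = "\<lambda>z. if 2 * z < int p then 2 * z + int p else 2 * z - int p"])
    fix x assume "x \<in> {x. x \<in> {1..2 * int p - 1} \<and> odd x \<and> x \<noteq> int p}"
    then have x: "1 \<le> x" "x < 2 * int p" "odd x" "x \<noteq> int p" by auto
    define z where "z = (if x > int p then (x - int p) div 2 else (x + int p) div 2)"
    have x_eq: "x = (if x > int p then 2 * z + int p else 2 * z - int p)"
      using x odd_p by (simp add: z_def)
    have "2 * z < int p \<longleftrightarrow> x > int p"
      using x x_eq by (auto split: if_splits)
    then show "(if 2 * (if x > int p then (x - int p) div 2 else (x + int p) div 2) < int p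
      then 2 * (if x > int p then (x - int p) div 2 else (x + int p) div 2) + int p
      else 2 * (if x > int p then (x - int p) div 2 else (x + int p) div 2) - int p) = x"
      using x_eq unfolding z_def[symmetric] by auto
    show "(if x > int p then (x - int p) div 2 else (x + int p) div 2) \<in> {1..int p - 1}"
      using x x_eq unfolding z_def[symmetric] by (auto split: if_splits)
    have "\<psi> x = \<psi> 2 * \<psi> z"
      using x_eq shift by (metis (full_types))
    moreover have "cot (pi * of_int x / (2 * real p)) = - tan (pi * of_int z / real p)"
    proof (cases "x > int p")
      case True
      with x_eq have "x = 2 * z + int p" by simp
      then have *: "real_of_int x = 2 * of_int z + real p" by simp
      have "pi * of_int x / (2 * real p) = pi * of_int z / real p + pi / 2"
        unfolding * using pos by (simp add: field_simps)
      then show ?thesis by (simp add: cot_def tan_def cos_add sin_add)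
    next
      case False
      with x_eq have "x = 2 * z - int p" by simp
      then have *: "real_of_int x = 2 * of_int z - real p" by simp
      have "pi * of_int x / (2 * real p) = pi * of_int z / real p - pi / 2"
        unfolding * using pos by (simp add: field_simps)
      then show ?thesis by (simp add: cot_def tan_def cos_diff sin_diff)
    qed
    ultimately show "- (\<psi> 2 * (\<psi> (if x > int p then (x - int p) div 2 else (x + int p) div 2) *
        of_real (tan (pi * of_int (if x > int p then (x - int p) div 2 else (x + int p) div 2)
          / real p)))) = \<psi> x * of_real (cot (pi * of_int x / (2 * real p)))"
      unfolding z_def[symmetric] by simp
  next
    fix z assume "z \<in> {1..int p - 1}"
    then have z: "1 \<le> z" "z < int p" by auto
    have "2 * z \<noteq> int p" using odd_p by (metis even_mult_iff even_of_nat even_numeral)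
    then show "(if int p < (if 2 * z < int p then 2 * z + int p else 2 * z - int p)
      then ((if 2 * z < int p then 2 * z + int p else 2 * z - int p) - int p) div 2
      else ((if 2 * z < int p then 2 * z + int p else 2 * z - int p) + int p) div 2) = z"
      using z by auto
    show "(if 2 * z < int p then 2 * z + int p else 2 * z - int p) \<in>
        {x. x \<in> {1..2 * int p - 1} \<and> odd x \<and> x \<noteq> int p}"
      using z odd_p \<open>2 * z \<noteq> int p\<close> by auto
  qed
  also have "\<dots> = - \<psi> 2 * (\<Sum>z=1..int p-1. \<psi> z * of_real (tan (pi * of_int z / real p)))"
    by (simp add: sum_distrib_left sum_negf)
  finally show ?thesis by simp
qed

text \<open>The prefactor is (pi / (2 p))^2 * 2 m * 4 p / m, from the L-value, the character sum,
  \<open>sum_cot_cot\<close> and the normalisation.\<close>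

lemma M_eq_sum_dedekind_sum:
  "M p H = 2 * pi\<^sup>2 / real p * (\<Sum>h\<in>H. dedekind_sum h (int p))"
proof -
  define f where "f = (\<lambda>x. cot (pi * of_int x / real p))"
  have period: "f (x + int p) = f x" for x
    using pos by (simp add: f_def cot_def ring_distribs add_divide_distrib)
  have odd: "f (- x) = - f x" for x by (simp add: f_def)
  have "(\<Sum>\<psi>\<in>odd_characters p H. (cmod (L_one \<psi>))\<^sup>2) = (\<Sum>\<psi>\<in>odd_characters p H.
      (pi / (2 * real p))\<^sup>2 * (cmod (\<Sum>x=1..int p-1. \<psi> x * of_real (f x)))\<^sup>2)"
    by (intro sum.cong refl)
       (simp add: L_one_odd_character f_def norm_mult power_mult_distrib norm_divide
         power_divide)
  also have "\<dots> = (pi / (2 * real p))\<^sup>2 * (2 * real m * (\<Sum>h\<in>H. \<Sum>x=1..int p-1. f x * f (h * x)))"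
    using sum_norm_square_twisted_sum[of f, OF period odd] by (simp flip: sum_distrib_left)
  also have "(\<Sum>h\<in>H. \<Sum>x=1..int p-1. f x * f (h * x)) =
      4 * real p * (\<Sum>h\<in>H. dedekind_sum h (int p))"
    using sum_cot_cot[of "int p"] pos by (simp add: f_def sum_distrib_left)
  finally show ?thesis
    using pos by (simp add: M_def card_odd_characters field_simps power2_eq_square)
qed

lemma M2_eq_sum_tan_tan:
  "M2 p H = pi\<^sup>2 / (8 * (real p)\<^sup>2) * (\<Sum>h\<in>H. \<Sum>x=1..int p-1.
      tan (pi * of_int x / real p) * tan (pi * of_int (h * x) / real p))"
proof -
  define f where "f = (\<lambda>x. tan (pi * of_int x / real p))"
  have period: "f (x + int p) = f x" for x
    using pos by (simp add: f_def ring_distribs add_divide_distrib)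
  have odd: "f (- x) = - f x" for x by (simp add: f_def)
  \<comment> \<open>Makes the factor \<open>\<psi> 2\<close> in the L-value unimodular.\<close>
  have "\<not> int p dvd 2" using pos zdvd_not_zless[of 2 "int p"] by simp
  then have "(\<Sum>\<psi>\<in>odd_characters p H. (cmod (L_one (induced_character (2 * p) \<psi>)))\<^sup>2) =
     (\<Sum>\<psi>\<in>odd_characters p H.
      (pi / (4 * real p))\<^sup>2 * (cmod (\<Sum>x=1..int p-1. \<psi> x * of_real (f x)))\<^sup>2)"
    by (intro sum.cong refl)
       (simp add: L_one_induced_character cmod_odd_character f_def norm_mult power_mult_distrib norm_divide
         power_divide)
  also have "\<dots> = (pi / (4 * real p))\<^sup>2 * (2 * real m * (\<Sum>h\<in>H. \<Sum>x=1..int p-1. f x * f (h * x)))"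
    using sum_norm_square_twisted_sum[of f, OF period odd] by (simp flip: sum_distrib_left)
  finally show ?thesis
    using pos by (simp add: M2_def card_odd_characters f_def field_simps power2_eq_square)
qed

end

section \<open>The subgroup of powers of a repunit base\<close>

locale repunit_prime_setting =
  fixes a :: int and d p :: nat
  assumes repunit_prime: "repunit_prime a d p"
begin

lemma basic: "prime d" "d \<ge> 3" "a \<notin> {-1, 0, 1}" "prime p" "[p = 1] (mod 2 * d)"
  using repunit_prime by (simp_all add: repunit_prime_def)

lemma odd_d: "odd d"
  using basic prime_odd_nat[of d] by simp

lemma mult_p: "(a - 1) * int p = a ^ d - 1"
proof -
  have "real p * (of_int a - 1) = of_int a ^ d - 1"
    using repunit_prime by (auto simp: repunit_prime_def)
  then have "real_of_int ((a - 1) * int p) = of_int (a ^ d - 1)"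
    by (simp add: mult.commute)
  then show ?thesis by (simp only: of_int_eq_iff)
qed

lemma p_eq_repunit: "int p = repunit a d"
  using mult_p power_eq_repunit[of a d] basic(3) by simp

lemma cong_power_d: "[a ^ d = 1] (mod int p)"
  unfolding cong_iff_dvd_diff mult_p[symmetric] by simp

definition m :: nat where "m = (p - 1) div (2 * d)"

lemma p_eq: "p = 2 * m * d + 1"
proof -
  have "2 * d dvd p - 1"
    using basic(5) prime_gt_1_nat[OF basic(4)] by (simp add: cong_altdef_nat cong_sym_eq)
  then have "p - 1 = 2 * d * m" by (simp add: m_def)
  then show ?thesis using prime_gt_1_nat[OF basic(4)] by (simp add: mult_ac)
qed

lemma d_less_p: "d < p"
proof -
  have "m > 0" using p_eq prime_gt_1_nat[OF basic(4)] by (intro Nat.gr0I) auto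
  then have "d \<le> m * d" by simp
  moreover have "p = 2 * (m * d) + 1" using p_eq by (simp only: mult.assoc)
  ultimately show ?thesis by linarith
qed

text \<open>Otherwise all \<open>d\<close> powers in the repunit are 1, and \<open>p\<close> divides
  the smaller number \<open>d\<close>.\<close>

lemma not_cong_1: "\<not> [a = 1] (mod int p)"
proof
  assume "[a = 1] (mod int p)"
  then have "[repunit a d = (\<Sum>i<d. 1 ^ i)] (mod int p)"
    unfolding repunit_def by (intro cong_sum cong_pow)
  then have "int p dvd int p - int d"
    by (simp add: p_eq_repunit[symmetric] cong_iff_dvd_diff)
  then have "int p dvd int p - (int p - int d)" by (rule dvd_diff[OF dvd_refl])
  then show False
    using d_less_p basic(2) by (simp add: nat_dvd_not_less)
qed

text \<open>A natural representative of the possibly negative \<open>a\<close>, as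
  \<open>ord\<close> acts on naturals.\<close>

definition b :: nat where "b = nat (a mod int p)"

lemma int_b: "int b = a mod int p"
  using prime_gt_0_nat[OF basic(4)] by (simp add: b_def)

lemma power_b: "int (b ^ k mod p) = a ^ k mod int p"
  by (simp add: of_nat_mod int_b power_mod)

text \<open>The order divides the prime \<open>d\<close> and is not 1.\<close>

lemma ord_b: "ord p b = d"
proof -
  have "[int b ^ d = a ^ d] (mod int p)" by (intro cong_pow) (simp add: int_b Cong.cong_def)
  then have "[int (b ^ d) = int 1] (mod int p)" using cong_power_d cong_trans by simp
  then have "ord p b dvd d" unfolding cong_int_iff ord_divides .
  moreover have "ord p b \<noteq> 1"
  proof
    assume "ord p b = 1"
    then have "[b ^ 1 = 1] (mod p)" unfolding ord_divides by simp
    then have "[int b = int 1] (mod int p)" unfolding cong_int_iff by simp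
    then show False using not_cong_1 by (simp add: int_b Cong.cong_def)
  qed
  ultimately show ?thesis using basic(1) unfolding prime_nat_iff by blast
qed

lemma inj_on_power: "inj_on (\<lambda>k. a ^ k mod int p) {..<d}"
proof (rule inj_onI)
  fix i j assume ij: "i \<in> {..<d}" "j \<in> {..<d}" "a ^ i mod int p = a ^ j mod int p"
  have "coprime p b" using ord_b basic(2) by (metis ord_eq_0 not_numeral_le_zero)
  moreover have "[b ^ i = b ^ j] (mod p)"
    using ij(3) power_b[of i] power_b[of j] by (simp add: Cong.cong_def del: of_nat_mod of_nat_power)
  ultimately have "[i = j] (mod d)" using order_divides_expdiff[of p b i j] ord_b by simp
  then show "i = j" using ij by (simp add: Cong.cong_def)
qed

abbreviation H :: "int set" where "H \<equiv> power_subgroup a d p"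

lemma power_subgroup_eq: "H = (\<lambda>k. a ^ k mod int p) ` {..<d}"
  using basic(2) by (auto simp: power_subgroup_def image_iff Bex_def)

lemma card_H: "card H = d"
  unfolding power_subgroup_eq by (simp add: card_image[OF inj_on_power])

lemma power_mem_H: "a ^ k mod int p \<in> H"
proof -
  have "[a ^ k = a ^ (k mod d)] (mod int p)"
    using cong_mult[OF cong_pow[OF cong_power_d, of "k div d"] cong_refl[of "a ^ (k mod d)"]]
    by (simp flip: power_mult power_add)
  then show ?thesis using basic(2) by (auto simp: power_subgroup_eq Cong.cong_def)
qed

lemma H_subset: "H \<subseteq> {1..int p - 1}"
proof
  fix h assume "h \<in> H"
  then obtain k where k: "k < d" "h = a ^ k mod int p" by (auto simp: power_subgroup_eq)
  have "\<not> int p dvd a ^ k"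
  proof
    assume "int p dvd a ^ k"
    then have "int p dvd a ^ k * a ^ (d - k)" by (rule dvd_mult2)
    then have "int p dvd a ^ d" using k(1) by (simp flip: power_add)
    then have "int p dvd 1" using cong_power_d cong_dvd_iff by (metis cong_dvd_modulus cong_iff_dvd_diff dvd_diff_right_iff)
    then show False using prime_gt_1_nat[OF basic(4)] by simp
  qed
  then have "h \<noteq> 0" using k by (simp add: dvd_eq_mod_eq_0)
  moreover have "0 \<le> h" "h < int p" using k prime_gt_0_nat[OF basic(4)] by auto
  ultimately show "h \<in> {1..int p - 1}" by simp
qed

sublocale odd_order_subgroup p d m H
proof
  fix h assume "h \<in> H"
  then obtain k where k: "h = a ^ k mod int p" by (auto simp: power_subgroup_eq)
  have "[h ^ d = (a ^ d) ^ k] (mod int p)"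
    unfolding k by (simp add: Cong.cong_def power_mod mult.commute flip: power_mult)
  also have "[(a ^ d) ^ k = 1 ^ k] (mod int p)" by (intro cong_pow cong_power_d)
  finally show "[h ^ d = 1] (mod int p)" by simp
qed (use basic p_eq odd_d card_H H_subset in auto)

lemma subgroup_H: "subgroup H (units_of (residue_ring (int p)))"
proof -
  interpret R: residues_prime p "residue_ring (int p)"
    by unfold_locales (use basic prime_gt_1_nat in auto)
  let ?G = "units_of (residue_ring (int p))"
  have G: "group ?G" by (rule R.units_group)
  have carrier: "carrier ?G = {1..int p - 1}"
    using pos by (simp add: units_of_carrier R.res_prime_units_eq of_nat_diff)
  have mult: "(a ^ i mod int p) \<otimes>\<^bsub>?G\<^esub> (a ^ j mod int p) = a ^ (i + j) mod int p" for i j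
    by (simp add: units_of_mult R.res_mult_eq mod_mult_eq power_add)
  show ?thesis
  proof (rule group.subgroupI[OF G])
    show "H \<subseteq> carrier ?G" using H_subset carrier by simp
    show "H \<noteq> {}" using power_mem_H[of 0] by auto
    fix x assume x: "x \<in> H"
    then obtain i where i: "i < d" "x = a ^ i mod int p" by (auto simp: power_subgroup_eq)
    have "(a ^ (d - i) mod int p) \<otimes>\<^bsub>?G\<^esub> x = \<one>\<^bsub>?G\<^esub>"
      using i cong_power_d pos by (simp add: mult units_of_one R.res_one_eq Cong.cong_def)
    moreover have "x \<in> carrier ?G" "a ^ (d - i) mod int p \<in> carrier ?G"
      using x power_mem_H H_subset unfolding carrier by blast+
    ultimately have "inv\<^bsub>?G\<^esub> x = a ^ (d - i) mod int p"
      by (intro group.inv_equality[OF G])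
    then show "inv\<^bsub>?G\<^esub> x \<in> H" using power_mem_H by simp
    fix y assume "y \<in> H"
    then obtain j where "y = a ^ j mod int p" by (auto simp: power_subgroup_eq)
    then show "x \<otimes>\<^bsub>?G\<^esub> y \<in> H" using i mult power_mem_H by simp
  qed
qed

text \<open>The summand at 1 is separated because the evaluations by reciprocity require
  \<open>0 < k < d\<close>.\<close>

lemma sum_H:
  assumes "\<And>x. f (x mod int p) = f x"
  shows "(\<Sum>h\<in>H. f h) = f 1 + (\<Sum>k=1..<d. f (a ^ k))"
proof -
  have "(\<Sum>h\<in>H. f h) = (\<Sum>k<d. f (a ^ k))"
    unfolding power_subgroup_eq by (simp add: sum.reindex[OF inj_on_power] assms)
  also have "{..<d} = insert 0 {1..<d}" using basic(2) by auto
  finally show ?thesis by simp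
qed

lemma modulus:
  assumes "k \<in> {1..<d}"
  shows "repunit_modulus a (int p) d k"
  using assms basic p_eq_repunit prime_gt_0_nat[OF basic(4)] by unfold_locales auto

text \<open>Merges the contributions of \<open>repunit a (d - k)\<close> and
  \<open>a ^ (d - k)\<close> with those of \<open>repunit a k\<close> and
  \<open>a ^ k\<close>.\<close>

lemma sum_reflect: "(\<Sum>k=1..<d. f (d - k)) = (\<Sum>k=1..<d. f k)"
  by (rule sum.reindex_bij_witness[where i = "\<lambda>k. d - k" and j = "\<lambda>k. d - k"]) auto

lemma sum_powers: "(\<Sum>k=1..<d. real_of_int (a ^ k)) = real p - 1"
proof -
  have "real p = of_int (repunit a d)" using p_eq_repunit by (metis of_int_of_nat_eq)
  also have "\<dots> = (\<Sum>k<d. real_of_int (a ^ k))" by (simp add: repunit_def)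
  also have "{..<d} = insert 0 {1..<d}" using basic(2) by auto
  finally show ?thesis by simp
qed

lemma sum_repunits: "(\<Sum>k=1..<d. real_of_int (repunit a k)) = (real p - real d) / (of_int a - 1)"
proof -
  have "(of_int a - 1) * (\<Sum>k=1..<d. real_of_int (repunit a k)) = (\<Sum>k=1..<d. of_int (a ^ k) - 1)"
    unfolding sum_distrib_left power_eq_repunit by simp
  also have "\<dots> = real p - real d"
    using sum_powers basic(2) by (simp add: sum_subtractf of_nat_diff)
  finally show ?thesis using basic(3) by (simp add: field_simps)
qed

lemma M_formula:
  "M p H = pi\<^sup>2 / 6 * ((of_int a + 1) / (of_int a - 1)) * (1 - ((real d - 1) * of_int a + 1) / real p)"
proof -
  define A P D where "A = real_of_int a" and "P = real p" and "D = real d"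
  have nz: "A - 1 \<noteq> 0" "P \<noteq> 0"
    using basic(3) pos by (auto simp: A_def P_def)
  have "12 * (\<Sum>h\<in>H. dedekind_sum h (int p)) =
      12 * dedekind_sum 1 (int p) + (\<Sum>k=1..<d. 12 * dedekind_sum (a ^ k) (int p))"
    by (subst sum_H) (auto intro!: dedekind_sum_cong simp: Cong.cong_def sum_distrib_left)
  also have "(\<Sum>k=1..<d. 12 * dedekind_sum (a ^ k) (int p)) =
      (\<Sum>k=1..<d. of_int (repunit a k) + of_int (repunit a (d - k)) - (A + 2)
        + (of_int (a ^ k) + of_int (a ^ (d - k))) / P)"
    using repunit_modulus.dedekind_sum_power[OF modulus]
    by (intro sum.cong refl) (simp add: A_def P_def)
  also have "\<dots> = 2 * (\<Sum>k=1..<d. of_int (repunit a k)) - (D - 1) * (A + 2)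
      + 2 * (\<Sum>k=1..<d. of_int (a ^ k)) / P"
    using basic(2) sum_reflect[of "\<lambda>k. real_of_int (repunit a k)"]
      sum_reflect[of "\<lambda>k. real_of_int (a ^ k)"]
    by (simp only: sum.distrib sum_subtractf sum_divide_distrib[symmetric])
       (simp add: D_def of_nat_diff algebra_simps)
  also have "12 * dedekind_sum 1 (int p) = (P - 1) * (P - 2) / P"
    using pos by (simp add: dedekind_sum_1 P_def field_simps)
  also have "(P - 1) * (P - 2) / P + (2 * (\<Sum>k=1..<d. of_int (repunit a k)) - (D - 1) * (A + 2)
      + 2 * (\<Sum>k=1..<d. of_int (a ^ k)) / P) =
      (A + 1) / (A - 1) * (P - ((D - 1) * A + 1))"
    unfolding sum_repunits sum_powers A_def[symmetric] P_def[symmetric] D_def[symmetric]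
    using nz by (simp add: divide_simps) (simp add: algebra_simps)
  finally have "12 * (\<Sum>h\<in>H. dedekind_sum h (int p)) = (A + 1) / (A - 1) * (P - ((D - 1) * A + 1))" .
  moreover have "M p H = pi\<^sup>2 / 6 / P * (12 * (\<Sum>h\<in>H. dedekind_sum h (int p)))"
    unfolding M_eq_sum_dedekind_sum P_def by simp
  ultimately have "M p H = pi\<^sup>2 / 6 / P * ((A + 1) / (A - 1) * (P - ((D - 1) * A + 1)))"
    by simp
  also have "\<dots> = pi\<^sup>2 / 6 * ((A + 1) / (A - 1)) * (1 - ((D - 1) * A + 1) / P)"
    using nz by (simp add: field_simps)
  finally show ?thesis by (simp only: A_def P_def D_def)
qed

lemma floor_sign_sum_1: "floor_sign_sum 1 (int p) = real p - 1"
  using pos by (simp add: floor_sign_sum_def)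

lemma M2_formula:
  "M2 p H = pi\<^sup>2 / 8 * (if odd a then (of_int a + 1) / (of_int a - 1) * (1 - real d / real p)
     else 1 - ((real d - 1) * of_int a + 1) / real p)"
proof -
  define A P D where "A = real_of_int a" and "P = real p" and "D = real d"
  have nz: "A - 1 \<noteq> 0" "P \<noteq> 0"
    using basic(3) pos by (auto simp: A_def P_def)
  \<comment> \<open>The tangent sum visibly depends on \<open>h\<close> modulo \<open>p\<close>
    only, unlike its evaluation, which splits by the parity of \<open>h\<close>. So the unreduced
    \<open>a ^ k\<close>, with the parity of \<open>a\<close>, may replace its residue in
    \<open>H\<close>.\<close>
  define T where "T = (\<lambda>h. \<Sum>x=1..int p-1. tan (pi * of_int x / real p) * tan (pi * of_int (h * x) / real p))"
  have T_eq: "T h = P * (if odd h then floor_sign_sum h (int p) else hardy_sum h (int p))"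
    if "coprime h (int p)" for h
    using sum_tan_tan[of "int p" h] that pos odd_p by (simp add: T_def P_def)
  have "T (h + int p) = T h" for h
  proof -
    have "tan (pi * of_int ((h + int p) * x) / real p) = tan (pi * of_int (h * x) / real p)" for x
    proof -
      have "pi * of_int ((h + int p) * x) / real p = pi * of_int (h * x) / real p + of_int x * pi"
        using pos by (simp add: field_simps)
      then show ?thesis by simp
    qed
    then show ?thesis by (simp add: T_def)
  qed
  then have "(\<Sum>h\<in>H. T h) = T 1 + (\<Sum>k=1..<d. T (a ^ k))"
    by (intro sum_H periodic_mod_int)
  also have "T 1 = P * (P - 1)" by (simp add: T_eq floor_sign_sum_1 P_def)
  also have "(\<Sum>k=1..<d. T (a ^ k)) =
      P * (\<Sum>k=1..<d. if odd a then floor_sign_sum (a ^ k) (int p) else hardy_sum (a ^ k) (int p))"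
    unfolding sum_distrib_left
    using repunit_modulus.coprime_p(1)[OF modulus] by (intro sum.cong refl) (auto simp: T_eq)
  finally have sum_T: "(\<Sum>h\<in>H. T h) = P * (P - 1 +
      (\<Sum>k=1..<d. if odd a then floor_sign_sum (a ^ k) (int p) else hardy_sum (a ^ k) (int p)))"
    by (simp add: distrib_left)
  have "P - 1 + (\<Sum>k=1..<d. if odd a then floor_sign_sum (a ^ k) (int p) else hardy_sum (a ^ k) (int p)) =
      (if odd a then (A + 1) / (A - 1) * (P - D) else P - ((D - 1) * A + 1))"
  proof (cases "odd a")
    case True
    have "(\<Sum>k=1..<d. floor_sign_sum (a ^ k) (int p)) =
        (\<Sum>k=1..<d. of_int (repunit a k) + of_int (repunit a (d - k)) - 1)"
      using repunit_modulus.floor_sign_sum_power[OF modulus True] by (intro sum.cong refl) simp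
    also have "\<dots> = 2 * (\<Sum>k=1..<d. of_int (repunit a k)) - (D - 1)"
      using basic(2) sum_reflect[of "\<lambda>k. real_of_int (repunit a k)"]
      by (simp only: sum.distrib sum_subtractf) (simp add: D_def of_nat_diff)
    also have "\<dots> = 2 * ((P - D) / (A - 1)) - (D - 1)"
      unfolding sum_repunits by (simp only: A_def P_def D_def)
    finally show ?thesis using nz True by (simp add: field_simps)
  next
    case False
    then have "(\<Sum>k=1..<d. hardy_sum (a ^ k) (int p)) = (\<Sum>k=1..<d. - A)"
      using repunit_modulus.hardy_sum_power[OF modulus] by (intro sum.cong refl) (simp add: A_def)
    also have "\<dots> = - ((D - 1) * A)" using basic(2) by (simp add: D_def of_nat_diff)
    finally show ?thesis using False by simp
  qed
  moreover have "M2 p H = pi\<^sup>2 / (8 * P\<^sup>2) * (\<Sum>h\<in>H. T h)"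
    unfolding M2_eq_sum_tan_tan T_def P_def ..
  ultimately have "M2 p H = pi\<^sup>2 / (8 * P\<^sup>2) * (P *
      (if odd a then (A + 1) / (A - 1) * (P - D) else P - ((D - 1) * A + 1)))"
    unfolding sum_T by simp
  also have "\<dots> = pi\<^sup>2 / 8 * (if odd a then (A + 1) / (A - 1) * (1 - D / P)
      else 1 - ((D - 1) * A + 1) / P)"
    using nz by (simp add: field_simps power2_eq_square)
  finally show ?thesis by (simp only: A_def P_def D_def)
qed

end

section \<open>Asymptotics\<close>

context repunit_prime_setting
begin

text \<open>For \<open>a > 0\<close> the left side is a term of the repunit. For
  \<open>a = - c\<close> with \<open>c \<ge> 2\<close> one has (c + 1) p = c^d + 1, and there the
  factor 2 is used.\<close>

lemma p_ge: "\<bar>real_of_int a\<bar> ^ (d - 1) \<le> 2 * real p"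
proof -
  have d: "d = Suc (d - 1)" using basic(2) by simp
  have "\<bar>a\<bar> ^ (d - 1) \<le> 2 * int p"
  proof (cases "a > 0")
    case True
    then have "a ^ (d - 1) \<le> repunit a d"
      unfolding repunit_def using basic(2) by (intro member_le_sum) auto
    then show ?thesis using True p_eq_repunit by simp
  next
    case False
    define c where "c = - a"
    have c: "c \<ge> 2" using False basic(3) by (auto simp: c_def)
    have "(c + 1) * int p = c ^ d + 1"
      using mult_p odd_d by (simp add: c_def power_minus_odd algebra_simps)
    moreover have "c ^ d = c * c ^ (d - 1)" by (subst d) simp
    moreover have "c ^ (d - 1) \<le> c * c ^ (d - 1)" using c by simp
    ultimately have "(c + 1) * c ^ (d - 1) \<le> (c + 1) * (2 * int p)"
      by (simp add: algebra_simps)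
    then have "c ^ (d - 1) \<le> 2 * int p" using c by simp
    then show ?thesis using False by (simp add: c_def)
  qed
  then have "real_of_int (\<bar>a\<bar> ^ (d - 1)) \<le> of_int (2 * int p)" by (simp only: of_int_le_iff)
  then show ?thesis by simp
qed

lemma abs_a_ge: "\<bar>real_of_int a\<bar> \<ge> 2"
proof -
  have "\<bar>a\<bar> \<ge> 2" using basic(3) by auto
  then have "real_of_int \<bar>a\<bar> \<ge> of_int 2" by (simp only: of_int_le_iff)
  then show ?thesis by simp
qed

lemma p_ge_square: "(real_of_int a)\<^sup>2 \<le> 2 * real p"
proof -
  have "\<bar>real_of_int a\<bar> ^ 2 \<le> \<bar>real_of_int a\<bar> ^ (d - 1)"
    using abs_a_ge basic(2) by (intro power_increasing) auto
  then show ?thesis using p_ge by simp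
qed

text \<open>Uniform in \<open>a\<close>: d^2 <= 2 * 2^d <= 4 * |a|^(d - 1) <= 8 p, and 8 is rounded
  up to the square 9.\<close>

lemma d_le: "real d \<le> 3 * sqrt (real p)"
proof -
  have "n\<^sup>2 \<le> 2 * 2 ^ n" if "n \<ge> 3" for n :: nat
    using that
  proof (induction n rule: nat_induct_at_least)
    case (Suc n)
    have "(Suc n)\<^sup>2 \<le> 2 * n\<^sup>2"
    proof -
      have "3 * n \<le> n * n" using Suc.hyps by (intro mult_right_mono) auto
      then have "Suc (n + n) \<le> n * n" using Suc.hyps by linarith
      then show ?thesis by (simp add: power2_eq_square)
    qed
    with Suc.IH show ?case by simp
  qed simp
  then have "d\<^sup>2 \<le> 2 * 2 ^ d" using basic(2) by blast
  then have "real (d\<^sup>2) \<le> real (2 * 2 ^ d)" by (simp only: of_nat_le_iff)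
  then have "(real d)\<^sup>2 \<le> 2 * 2 ^ d" by simp
  also have "(2::real) ^ d = 2 * 2 ^ (d - 1)"
    using basic(2) by (subst power_Suc[symmetric]) simp
  also have "(2::real) ^ (d - 1) \<le> \<bar>of_int a\<bar> ^ (d - 1)"
    using abs_a_ge by (intro power_mono) auto
  also have "\<dots> \<le> 2 * real p" by (rule p_ge)
  finally have "(real d)\<^sup>2 \<le> (3 * sqrt (real p))\<^sup>2" by (simp add: power_mult_distrib)
  then show ?thesis by (rule power2_le_imp_le) simp
qed

lemma p_le: "real p \<le> real d * \<bar>real_of_int a\<bar> ^ (d - 1)"
proof -
  have "real p = of_int (repunit a d)" using p_eq_repunit by (metis of_int_of_nat_eq)
  also have "\<dots> \<le> (\<Sum>i<d. \<bar>real_of_int a\<bar> ^ i)"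
    unfolding repunit_def of_int_sum
    by (intro sum_mono) (metis abs_ge_self of_int_power power_abs)
  also have "\<dots> \<le> (\<Sum>i<d. \<bar>real_of_int a\<bar> ^ (d - 1))"
    using abs_a_ge by (intro sum_mono power_increasing) auto
  finally show ?thesis by simp
qed

lemma abs_linear_le: "\<bar>(real d - 1) * real_of_int a + 1\<bar> \<le> real d * \<bar>real_of_int a\<bar>"
proof -
  have "\<bar>(real d - 1) * real_of_int a + 1\<bar> \<le> \<bar>(real d - 1) * real_of_int a\<bar> + 1" by linarith
  also have "\<bar>(real d - 1) * real_of_int a\<bar> = (real d - 1) * \<bar>real_of_int a\<bar>"
    using basic(2) by (simp add: abs_mult)
  also have "\<dots> + 1 \<le> real d * \<bar>real_of_int a\<bar>" using abs_a_ge by (simp add: algebra_simps)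
  finally show ?thesis .
qed

end

section \<open>Limits along the filter of admissible primes\<close>

lemma eventually_p_to_infinity:
  assumes "\<And>x p. p > N \<Longrightarrow> P x p \<Longrightarrow> Q x p"
  shows "eventually (\<lambda>(x, p). Q x p) (p_to_infinity P)"
proof -
  have "eventually (\<lambda>y. snd y > N) (filtercomap snd at_top)"
    using eventually_filtercomapI[OF eventually_gt_at_top[of N], of snd] .
  then have "eventually (\<lambda>y. y \<in> {(x, p). P x p} \<longrightarrow> (case y of (x, p) \<Rightarrow> Q x p)) (filtercomap snd at_top)"
    by eventually_elim (use assms in auto)
  then show ?thesis by (simp add: p_to_infinity_def eventually_inf_principal)
qed

lemma filterlim_real_p_to_infinity:
  "filterlim (\<lambda>(x, p). real p) at_top (p_to_infinity P)"
  unfolding filterlim_at_top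
proof
  fix Z :: real
  show "eventually (\<lambda>y. Z \<le> (case y of (x, p) \<Rightarrow> real p)) (p_to_infinity P)"
    using eventually_p_to_infinity[of "nat \<lceil>Z\<rceil>" P "\<lambda>x p. Z \<le> real p"]
    by (simp add: case_prod_unfold) linarith
qed

lemma smallo_1_p_to_infinity:
  fixes f g :: "'a \<Rightarrow> nat \<Rightarrow> real"
  assumes "\<And>x p. P x p \<Longrightarrow> f x p = g x p"
    and "((\<lambda>(x, p). g x p) \<longlongrightarrow> c) (p_to_infinity P)"
  shows "(\<lambda>(x, p). f x p - c) \<in> o[p_to_infinity P](\<lambda>_. 1)"
proof (rule smalloI_tendsto)
  have "((\<lambda>(x, p). f x p) \<longlongrightarrow> c) (p_to_infinity P)"
  proof (rule Lim_transform_eventually[OF assms(2)])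
    show "eventually (\<lambda>y. (case y of (x, p) \<Rightarrow> g x p) = (case y of (x, p) \<Rightarrow> f x p)) (p_to_infinity P)"
      using eventually_p_to_infinity[of 0 P "\<lambda>x p. g x p = f x p"] assms(1)
      by (simp add: case_prod_unfold)
  qed
  from tendsto_diff[OF this tendsto_const[of c]]
  show "((\<lambda>y. (case y of (x, p) \<Rightarrow> f x p - c) / 1) \<longlongrightarrow> 0) (p_to_infinity P)"
    by (simp add: case_prod_unfold)
qed simp

lemma tendsto_0_p_to_infinity:
  fixes f h :: "'a \<Rightarrow> nat \<Rightarrow> real"
  assumes "\<And>x p. P x p \<Longrightarrow> \<bar>f x p\<bar> \<le> h x p"
    and "((\<lambda>(x, p). h x p) \<longlongrightarrow> 0) (p_to_infinity P)"
  shows "((\<lambda>(x, p). f x p) \<longlongrightarrow> 0) (p_to_infinity P)"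
proof (rule Lim_null_comparison[OF _ assms(2)])
  show "eventually (\<lambda>y. norm (case y of (x, p) \<Rightarrow> f x p) \<le> (case y of (x, p) \<Rightarrow> h x p)) (p_to_infinity P)"
    using eventually_p_to_infinity[of 0 P "\<lambda>x p. \<bar>f x p\<bar> \<le> h x p"] assms(1)
    by (simp add: case_prod_unfold)
qed

lemma tendsto_const_over_sqrt_p:
  "((\<lambda>(x, p). c / sqrt (real p)) \<longlongrightarrow> 0) (p_to_infinity P)"
proof -
  have "filterlim (\<lambda>y. sqrt (real (snd y))) at_top (p_to_infinity P)"
    using filterlim_compose[OF sqrt_at_top filterlim_real_p_to_infinity[of P]]
    by (simp add: case_prod_unfold)
  from tendsto_divide_0[OF tendsto_const filterlim_at_top_imp_at_infinity[OF this]]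
  show ?thesis by (simp add: case_prod_unfold)
qed

text \<open>For fixed \<open>d\<close>, a bound on |a| bounds \<open>p\<close> by
  \<open>p_le\<close>; hence |a| tends to infinity with \<open>p\<close>.\<close>

lemma tendsto_inverse_abs_a:
  "((\<lambda>(a, p). c / \<bar>real_of_int a\<bar>) \<longlongrightarrow> 0) (p_to_infinity (\<lambda>a p. repunit_prime a d p))"
proof -
  let ?F = "p_to_infinity (\<lambda>a p. repunit_prime a d p)"
  have "filterlim (\<lambda>y. \<bar>real_of_int (fst y)\<bar>) at_top ?F"
    unfolding filterlim_at_top
  proof
    fix Z :: real
    define N where "N = nat \<lceil>real d * \<bar>Z\<bar> ^ (d - 1)\<rceil>"
    have "Z \<le> \<bar>real_of_int a\<bar>" if "p > N" "repunit_prime a d p" for a p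
    proof (rule ccontr)
      interpret repunit_prime_setting a d p by standard fact
      assume "\<not> ?thesis"
      then have "\<bar>real_of_int a\<bar> ^ (d - 1) \<le> \<bar>Z\<bar> ^ (d - 1)"
        by (intro power_mono) auto
      then have "real d * \<bar>real_of_int a\<bar> ^ (d - 1) \<le> real d * \<bar>Z\<bar> ^ (d - 1)"
        by (intro mult_left_mono) auto
      also have "\<dots> \<le> real N" unfolding N_def by (rule real_nat_ceiling_ge)
      also have "\<dots> < real p" using that by simp
      finally show False using p_le by simp
    qed
    then show "eventually (\<lambda>y. Z \<le> \<bar>real_of_int (fst y)\<bar>) ?F"
      using eventually_p_to_infinity[of N "\<lambda>a p. repunit_prime a d p" "\<lambda>a p. Z \<le> \<bar>real_of_int a\<bar>"]
      by (simp add: case_prod_unfold)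
  qed
  from tendsto_divide_0[OF tendsto_const filterlim_at_top_imp_at_infinity[OF this]]
  show ?thesis by (simp add: case_prod_unfold)
qed

text \<open>The factor is 1 + 2 / (a - 1), and a^2 <= 2 p makes d / p and ((d - 1) a + 1) / p of
  size O(1 / |a|); all of these errors vanish as |a| grows.\<close>

lemma asymptotics_fixed_d:
  fixes d :: nat
  defines "F \<equiv> p_to_infinity (\<lambda>a p. repunit_prime a d p)"
  shows "(\<lambda>(a, p). M p (power_subgroup a d p) - pi\<^sup>2 / 6) \<in> o[F](\<lambda>_. 1)"
    and "(\<lambda>(a, p). M2 p (power_subgroup a d p) - pi\<^sup>2 / 8) \<in> o[F](\<lambda>_. 1)"
proof -
  have quotient: "((\<lambda>(a, p). (real_of_int a + 1) / (of_int a - 1)) \<longlongrightarrow> 1) F"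
  proof -
    have "((\<lambda>(a, p). 2 / (real_of_int a - 1)) \<longlongrightarrow> 0) F"
      unfolding F_def
    proof (rule tendsto_0_p_to_infinity[OF _ tendsto_inverse_abs_a[of 4]])
      fix a p assume "repunit_prime a d p"
      then interpret repunit_prime_setting a d p by unfold_locales
      \<comment> \<open>From |a| >= 2 follows |a - 1| >= |a| / 2, whence the constant 4.\<close>
      show "\<bar>2 / (real_of_int a - 1)\<bar> \<le> 4 / \<bar>real_of_int a\<bar>"
        using abs_a_ge by (simp add: abs_divide divide_simps abs_if split: if_splits)
    qed
    from tendsto_add[OF tendsto_const[of 1] this]
    have "((\<lambda>(a, p). 1 + 2 / (real_of_int a - 1)) \<longlongrightarrow> 1) F" by (simp add: case_prod_unfold)
    then show ?thesis
    proof (rule Lim_transform_eventually)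
      have "1 + 2 / (real_of_int a - 1) = (real_of_int a + 1) / (of_int a - 1)"
        if "repunit_prime a d p" for a p
      proof -
        interpret repunit_prime_setting a d p by unfold_locales fact
        have "real_of_int a - 1 \<noteq> 0" using basic(3) by auto
        then show ?thesis by (simp add: field_simps)
      qed
      then show "eventually (\<lambda>y. (case y of (a, p) \<Rightarrow> 1 + 2 / (real_of_int a - 1)) =
          (case y of (a, p) \<Rightarrow> (real_of_int a + 1) / (of_int a - 1))) F"
        unfolding F_def
        using eventually_p_to_infinity[of 0 "\<lambda>a p. repunit_prime a d p"
            "\<lambda>a p. 1 + 2 / (real_of_int a - 1) = (real_of_int a + 1) / (of_int a - 1)"]
        by (simp add: case_prod_unfold)
    qed
  qed
  have e: "((\<lambda>(a, p). ((real d - 1) * real_of_int a + 1) / real p) \<longlongrightarrow> 0) F"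
    unfolding F_def
  proof (rule tendsto_0_p_to_infinity[OF _ tendsto_inverse_abs_a[of "2 * real d"]])
    fix a p assume "repunit_prime a d p"
    then interpret repunit_prime_setting a d p by unfold_locales
    have "real d * \<bar>real_of_int a\<bar> * \<bar>real_of_int a\<bar> \<le> real d * (2 * real p)"
      using p_ge_square by (simp add: mult.assoc mult_left_mono power2_eq_square)
    then have "real d * \<bar>real_of_int a\<bar> \<le> 2 * real d / \<bar>real_of_int a\<bar> * real p"
      using abs_a_ge by (simp add: field_simps)
    then have "\<bar>(real d - 1) * real_of_int a + 1\<bar> \<le> 2 * real d / \<bar>real_of_int a\<bar> * real p"
      using abs_linear_le by linarith
    then show "\<bar>((real d - 1) * real_of_int a + 1) / real p\<bar> \<le> 2 * real d / \<bar>real_of_int a\<bar>"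
      using pos by (simp add: abs_divide pos_divide_le_eq)
  qed
  have f: "((\<lambda>(a, p). real d / real p) \<longlongrightarrow> 0) F"
    unfolding F_def
  proof (rule tendsto_0_p_to_infinity[OF _ tendsto_inverse_abs_a[of "2 * real d"]])
    fix a p assume "repunit_prime a d p"
    then interpret repunit_prime_setting a d p by unfold_locales
    have "\<bar>real_of_int a\<bar> * 1 \<le> \<bar>real_of_int a\<bar> * \<bar>real_of_int a\<bar>"
      using abs_a_ge by (intro mult_left_mono) auto
    then have "\<bar>real_of_int a\<bar> \<le> 2 * real p" using p_ge_square by (simp add: power2_eq_square)
    then show "\<bar>real d / real p\<bar> \<le> 2 * real d / \<bar>real_of_int a\<bar>"
      using pos abs_a_ge by (simp add: divide_simps)
  qed
  have main: "((\<lambda>(a, p). 1 - ((real d - 1) * real_of_int a + 1) / real p) \<longlongrightarrow> 1) F"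
    using tendsto_diff[OF tendsto_const[of 1] e] by (simp add: case_prod_unfold)
  show "(\<lambda>(a, p). M p (power_subgroup a d p) - pi\<^sup>2 / 6) \<in> o[F](\<lambda>_. 1)"
    unfolding F_def
  proof (rule smallo_1_p_to_infinity)
    show "((\<lambda>(a, p). pi\<^sup>2 / 6 * ((real_of_int a + 1) / (of_int a - 1)) *
        (1 - ((real d - 1) * of_int a + 1) / real p)) \<longlongrightarrow> pi\<^sup>2 / 6) (p_to_infinity (\<lambda>a p. repunit_prime a d p))"
      using tendsto_mult[OF tendsto_mult[OF tendsto_const[of "pi\<^sup>2 / 6"] quotient] main]
      by (simp add: case_prod_unfold F_def)
  qed (simp add: repunit_prime_setting.M_formula repunit_prime_setting_def)
  have odd: "((\<lambda>(a, p). (real_of_int a + 1) / (of_int a - 1) * (1 - real d / real p)) \<longlongrightarrow> 1) F"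
    using tendsto_mult[OF quotient tendsto_diff[OF tendsto_const[of 1] f]] by (simp add: case_prod_unfold)
  \<comment> \<open>Odd and even \<open>a\<close> may both occur along the filter; each branch has
    limit 1.\<close>
  have "((\<lambda>y. if odd (fst y) then case y of (a, p) \<Rightarrow> (real_of_int a + 1) / (of_int a - 1) * (1 - real d / real p)
      else case y of (a, p) \<Rightarrow> 1 - ((real d - 1) * real_of_int a + 1) / real p) \<longlongrightarrow> 1) F"
    by (intro filterlim_If tendsto_mono[OF _ odd] tendsto_mono[OF _ main]) auto
  from tendsto_mult[OF tendsto_const[of "pi\<^sup>2 / 8"] this]
  have "((\<lambda>(a, p). pi\<^sup>2 / 8 * (if odd a then (real_of_int a + 1) / (of_int a - 1) * (1 - real d / real p)
      else 1 - ((real d - 1) * of_int a + 1) / real p)) \<longlongrightarrow> pi\<^sup>2 / 8) F"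
    by (simp add: case_prod_unfold cong: if_cong)
  then show "(\<lambda>(a, p). M2 p (power_subgroup a d p) - pi\<^sup>2 / 8) \<in> o[F](\<lambda>_. 1)"
    unfolding F_def
    by (rule smallo_1_p_to_infinity[rotated])
       (simp add: repunit_prime_setting.M2_formula repunit_prime_setting_def)
qed

text \<open>With \<open>a\<close> constant, \<open>d_le\<close> makes d / p, and so every error term
  of the closed formulas, of size O(1 / sqrt p).\<close>

lemma asymptotics_fixed_a:
  fixes a :: int
  defines "F \<equiv> p_to_infinity (\<lambda>d p. repunit_prime a d p)"
  shows "(\<lambda>(d, p). M p (power_subgroup a d p) - pi\<^sup>2 / 6 * ((real_of_int a + 1) / (real_of_int a - 1)))
      \<in> o[F](\<lambda>_. 1)"
    and "odd a \<Longrightarrow> (\<lambda>(d, p). M2 p (power_subgroup a d p)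
      - pi\<^sup>2 / 8 * ((real_of_int a + 1) / (real_of_int a - 1))) \<in> o[F](\<lambda>_. 1)"
    and "even a \<Longrightarrow> (\<lambda>(d, p). M2 p (power_subgroup a d p) - pi\<^sup>2 / 8) \<in> o[F](\<lambda>_. 1)"
proof -
  have d_over_p: "real d / real p \<le> 3 / sqrt (real p)" if "repunit_prime a d p" for d p
  proof -
    interpret repunit_prime_setting a d p by unfold_locales fact
    have "real d / real p \<le> 3 * sqrt (real p) / real p" by (intro divide_right_mono d_le) simp
    also have "\<dots> = 3 / sqrt (real p)"
      using pos by (simp add: field_simps flip: power2_eq_square)
    finally show ?thesis .
  qed
  have f: "((\<lambda>(d, p). real d / real p) \<longlongrightarrow> 0) F"
    unfolding F_def
    by (rule tendsto_0_p_to_infinity[OF _ tendsto_const_over_sqrt_p[of 3]]) (simp add: d_over_p)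
  have "((\<lambda>(d, p). ((real d - 1) * real_of_int a + 1) / real p) \<longlongrightarrow> 0) F"
    unfolding F_def
  proof (rule tendsto_0_p_to_infinity[OF _ tendsto_const_over_sqrt_p[of "3 * \<bar>real_of_int a\<bar>"]])
    fix d p assume rp: "repunit_prime a d p"
    then interpret repunit_prime_setting a d p by unfold_locales
    have "\<bar>((real d - 1) * real_of_int a + 1) / real p\<bar> \<le> real d * \<bar>real_of_int a\<bar> / real p"
      using abs_linear_le by (simp add: abs_divide divide_right_mono)
    also have "\<dots> = \<bar>real_of_int a\<bar> * (real d / real p)" by simp
    also have "\<dots> \<le> \<bar>real_of_int a\<bar> * (3 / sqrt (real p))" by (intro mult_left_mono d_over_p rp) simp
    finally show "\<bar>((real d - 1) * real_of_int a + 1) / real p\<bar> \<le> 3 * \<bar>real_of_int a\<bar> / sqrt (real p)"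
      by (simp add: mult.commute)
  qed
  from tendsto_diff[OF tendsto_const[of 1] this]
  have main: "((\<lambda>(d, p). 1 - ((real d - 1) * real_of_int a + 1) / real p) \<longlongrightarrow> 1) F"
    by (simp add: case_prod_unfold)
  show "(\<lambda>(d, p). M p (power_subgroup a d p) - pi\<^sup>2 / 6 * ((real_of_int a + 1) / (real_of_int a - 1)))
      \<in> o[F](\<lambda>_. 1)"
    unfolding F_def
  proof (rule smallo_1_p_to_infinity)
    show "((\<lambda>(d, p). pi\<^sup>2 / 6 * ((real_of_int a + 1) / (of_int a - 1)) *
        (1 - ((real d - 1) * of_int a + 1) / real p)) \<longlongrightarrow>
        pi\<^sup>2 / 6 * ((real_of_int a + 1) / (real_of_int a - 1))) (p_to_infinity (\<lambda>d p. repunit_prime a d p))"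
      using tendsto_mult[OF tendsto_const[of "pi\<^sup>2 / 6 * ((real_of_int a + 1) / (of_int a - 1))"] main]
      by (simp add: case_prod_unfold F_def)
  qed (simp add: repunit_prime_setting.M_formula repunit_prime_setting_def)
  show "(\<lambda>(d, p). M2 p (power_subgroup a d p)
      - pi\<^sup>2 / 8 * ((real_of_int a + 1) / (real_of_int a - 1))) \<in> o[F](\<lambda>_. 1)" if "odd a"
    unfolding F_def
  proof (rule smallo_1_p_to_infinity)
    show "((\<lambda>(d, p). pi\<^sup>2 / 8 * ((real_of_int a + 1) / (of_int a - 1)) * (1 - real d / real p)) \<longlongrightarrow>
        pi\<^sup>2 / 8 * ((real_of_int a + 1) / (real_of_int a - 1))) (p_to_infinity (\<lambda>d p. repunit_prime a d p))"
      using tendsto_mult[OF tendsto_const[of "pi\<^sup>2 / 8 * ((real_of_int a + 1) / (of_int a - 1))"]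
          tendsto_diff[OF tendsto_const[of 1] f]]
      by (simp add: case_prod_unfold F_def)
  qed (simp add: repunit_prime_setting.M2_formula repunit_prime_setting_def that)
  show "(\<lambda>(d, p). M2 p (power_subgroup a d p) - pi\<^sup>2 / 8) \<in> o[F](\<lambda>_. 1)" if "even a"
    unfolding F_def
  proof (rule smallo_1_p_to_infinity)
    show "((\<lambda>(d, p). pi\<^sup>2 / 8 * (1 - ((real d - 1) * of_int a + 1) / real p)) \<longlongrightarrow> pi\<^sup>2 / 8)
        (p_to_infinity (\<lambda>d p. repunit_prime a d p))"
      using tendsto_mult[OF tendsto_const[of "pi\<^sup>2 / 8"] main]
      by (simp add: case_prod_unfold F_def)
  qed (simp add: repunit_prime_setting.M2_formula repunit_prime_setting_def that)
qed

theorem theorem5p2: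
  "(\<forall>(a::int) (d::nat) (p::nat). repunit_prime a d p \<longrightarrow>
      subgroup (power_subgroup a d p) (units_of (residue_ring (int p))) \<and>
      card (power_subgroup a d p) = d \<and>
      M p (power_subgroup a d p) =
        pi\<^sup>2 / 6 * ((real_of_int a + 1) / (real_of_int a - 1)) *
          (1 - ((real d - 1) * real_of_int a + 1) / real p) \<and>
      M2 p (power_subgroup a d p) =
        pi\<^sup>2 / 8 *
          (if odd a
           then (real_of_int a + 1) / (real_of_int a - 1) * (1 - real d / real p)
           else 1 - ((real d - 1) * real_of_int a + 1) / real p))
   \<and>
   (\<forall>d::nat. prime d \<and> d \<ge> 3 \<longrightarrow>
      (\<lambda>(a, p). M p (power_subgroup a d p) - pi\<^sup>2 / 6)
        \<in> o[p_to_infinity (\<lambda>a p. repunit_prime a d p)](\<lambda>_. 1) \<and>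
      (\<lambda>(a, p). M2 p (power_subgroup a d p) - pi\<^sup>2 / 8)
        \<in> o[p_to_infinity (\<lambda>a p. repunit_prime a d p)](\<lambda>_. 1))
   \<and>
   (\<forall>a::int. a \<notin> {- 1, 0, 1} \<longrightarrow>
      (\<lambda>(d, p). M p (power_subgroup a d p)
                  - pi\<^sup>2 / 6 * ((real_of_int a + 1) / (real_of_int a - 1)))
        \<in> o[p_to_infinity (\<lambda>d p. repunit_prime a d p)](\<lambda>_. 1) \<and>
      (odd a \<longrightarrow>
        (\<lambda>(d, p). M2 p (power_subgroup a d p)
                    - pi\<^sup>2 / 8 * ((real_of_int a + 1) / (real_of_int a - 1)))
          \<in> o[p_to_infinity (\<lambda>d p. repunit_prime a d p)](\<lambda>_. 1)) \<and>
      (even a \<longrightarrow>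
        (\<lambda>(d, p). M2 p (power_subgroup a d p) - pi\<^sup>2 / 8)
          \<in> o[p_to_infinity (\<lambda>d p. repunit_prime a d p)](\<lambda>_. 1)))"
proof (intro conjI allI impI)
  fix a :: int and d p :: nat
  assume "repunit_prime a d p"
  then interpret repunit_prime_setting a d p by unfold_locales
  show "subgroup H (units_of (residue_ring (int p)))" by (rule subgroup_H)
  show "card H = d" by (rule card_H)
  show "M p H = pi\<^sup>2 / 6 * ((real_of_int a + 1) / (real_of_int a - 1)) *
      (1 - ((real d - 1) * real_of_int a + 1) / real p)" by (rule M_formula)
  show "M2 p H = pi\<^sup>2 / 8 *
      (if odd a then (real_of_int a + 1) / (real_of_int a - 1) * (1 - real d / real p)
       else 1 - ((real d - 1) * real_of_int a + 1) / real p)" by (rule M2_formula)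
qed (use asymptotics_fixed_d asymptotics_fixed_a in blast)+

end
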